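(* Fix $\alpha\in(2,3]$ and assume $\eta\ge 3^{1/3}\,2^{1/6}$. Consider the class $\mathcal{P}_{\alpha,\eta}$. Then there exists some $C_\alpha>0$ depending only on $\alpha$ such that, if $k_\alpha=\lceil C_\alpha\,\eta^{(2\alpha)/(\alpha-2)}\rceil$, the following hold. 1. When $n\ge(3+\ln 4)\,124\,k_\alpha$, there is a multiple-$\delta$ $L_*$-sub-Gaussian estimator for the $k_\alpha$-regular class, i.e. for $(\mathcal{P}_{2,k_\alpha\text{-reg}},n,\delta_{\min,n,k_\alpha})$, and this same estimator is a multiple-$\delta$ $L_*$-sub-Gaussian estimator for $(\mathcal{P}_{\alpha,\eta},n,\delta_{\min,n,k_\alpha})$. 2. On the other hand, for any $L\ge\sqrt2$, there exist $n_{0,\alpha,L}\in\mathbb{N}$ and $c_{\alpha,L}>0$ such that no multiple-$\delta$ $L$-sub-Gaussian estimator can exist for $(\mathcal{P}_{\alpha,\eta},n,e^{1-c_{\alpha,L}\,n/k_\alpha})$ when $n\ge n_{0,\alpha,L}$. 3. Finally, for $L\ge\sqrt2$ there is no $\delta$-dependent $L$-sub-Gaussian estimator for $(\mathcal{P}_{\alpha,\eta},n,e^{1-5L^2n})$.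
   Context: $\mathcal{P}_2$ is the class of all probability distributions on $\mathbb{R}$ with finite second moment; $\mu_P,\sigma_P^2$ denote the mean and variance of $P\in\mathcal{P}_2$. For $\eta\ge1$ and $\alpha\in(2,3]$, $\mathcal{P}_{\alpha,\eta}=\{P\in\mathcal{P}_2:\ \mathbb{E}_{X\sim P}|X-\mu_P|^\alpha\le(\eta\,\sigma_P)^\alpha\}$. For $P\in\mathcal{P}_2$ and a positive integer $j$, with $X_1,\dots,X_j$ i.i.d. from $P$, let $p_-(P,j)=\mathbb{P}\left(\sum_{i=1}^jX_i\le j\mu_P\right)$ and $p_+(P,j)=\mathbb{P}\left(\sum_{i=1}^jX_i\ge j\mu_P\right)$; the $k$-regular class is $\mathcal{P}_{2,k\text{-reg}}=\{P\in\mathcal{P}_2:\ \forall j\ge k,\ \min(p_+(P,j),p_-(P,j))\ge 1/3\}$. The constants are $L_*=4\sqrt{2(1+2\ln 2)(1+62\ln 3)}\,e^{5/2}$ and $\delta_{\min,n,k}=4e^{3-n/(124k)}$ for positive integers $n,k$. Let $n$ be a positive integer, $L>0$, $\delta_{\min}\in(0,1)$, $\mathcal{P}\subset\mathcal{P}_2$. A $\delta$-dependent $L$-sub-Gaussian estimator for $(\mathcal{P},n,\delta_{\min})$ is a measurable map $\widehat{E}_n:\mathbb{R}^n\times[\delta_{\min},1)\to\mathbb{R}$ such that for all $P\in\mathcal{P}$ and $\delta\in[\delta_{\min},1)$, if $X_1^n=(X_1,\dots,X_n)$ is an i.i.d. sample from $P$, then $\mathbb{P}\left(|\widehat{E}_n(X_1^n,\delta)-\mu_P|>L\,\sigma_P\sqrt{\frac{1+\ln(1/\delta)}{n}}\right)\le\delta$.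 A multiple-$\delta$ $L$-sub-Gaussian estimator for $(\mathcal{P},n,\delta_{\min})$ is a measurable map $\widehat{E}_n:\mathbb{R}^n\to\mathbb{R}$ (not depending on $\delta$) such that for all $\delta\in[\delta_{\min},1)$, $P\in\mathcal{P}$ and i.i.d. samples $X_1^n$ from $P$, $\mathbb{P}\left(|\widehat{E}_n(X_1^n)-\mu_P|>L\,\sigma_P\sqrt{\frac{1+\ln(1/\delta)}{n}}\right)\le\delta$.
   Formalization: In part 2 the threshold n_0 may depend on η as well as on α and L; a threshold uniform in η is impossible, since for L=√2 and large η the empirical mean is such an estimator when 1 < c n/k_α < 1.3. *)

theory Defs
  imports "HOL-Probability.Probability"
begin

definition P2 :: "real measure set" where
  "P2 = {P. real_distribution P \<and> integrable P (\<lambda>x. x\<^sup>2)}"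

definition dist_mean :: "real measure \<Rightarrow> real" where
  "dist_mean P = prob_space.expectation P (\<lambda>x. x)"

definition dist_sd :: "real measure \<Rightarrow> real" where
  "dist_sd P = sqrt (prob_space.variance P (\<lambda>x. x))"

text \<open>Integrability of the \<open>\<alpha>\<close>-th absolute central moment is demanded explicitly, since a
  Bochner integral of a non-integrable function is \<open>0\<close> and the bound would then hold trivially.\<close>

definition P_moment :: "real \<Rightarrow> real \<Rightarrow> real measure set" where
  "P_moment \<alpha> \<eta> = {P \<in> P2.
     integrable P (\<lambda>x. \<bar>x - dist_mean P\<bar> powr \<alpha>) \<and>
     prob_space.expectation P (\<lambda>x. \<bar>x - dist_mean P\<bar> powr \<alpha>) \<le> (\<eta> * dist_sd P) powr \<alpha>}"

text \<open>The joint law on \<open>\<real>\<^sup>n\<close> of an i.i.d. sample of size \<open>n\<close>; the coordinates are indexed by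
  \<open>0, \<dots>, n - 1\<close>.\<close>

definition iid_sample :: "real measure \<Rightarrow> nat \<Rightarrow> (nat \<Rightarrow> real) measure" where
  "iid_sample P n = (\<Pi>\<^sub>M i\<in>{..<n}. P)"

definition p_minus :: "real measure \<Rightarrow> nat \<Rightarrow> real" where
  "p_minus P j = \<P>(x in iid_sample P j. (\<Sum>i<j. x i) \<le> real j * dist_mean P)"

definition p_plus :: "real measure \<Rightarrow> nat \<Rightarrow> real" where
  "p_plus P j = \<P>(x in iid_sample P j. (\<Sum>i<j. x i) \<ge> real j * dist_mean P)"

definition P2_reg :: "nat \<Rightarrow> real measure set" where
  "P2_reg k = {P \<in> P2. \<forall>j\<ge>k. min (p_plus P j) (p_minus P j) \<ge> 1/3}"

definition subgaussian_radius :: "real \<Rightarrow> real measure \<Rightarrow> nat \<Rightarrow> real \<Rightarrow> real" where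
  "subgaussian_radius L P n \<delta> = L * dist_sd P * sqrt ((1 + ln (1 / \<delta>)) / real n)"

text \<open>The two notions of estimator are meant for \<open>n \<ge> 1\<close>, \<open>L > 0\<close> and \<open>0 < \<delta>min < 1\<close>. This range
  is not built into the predicates: for \<open>\<delta>min \<ge> 1\<close> every measurable map qualifies, so that a
  non-existence claim can never hold merely because \<open>\<delta>min\<close> lies outside the range.\<close>

definition delta_dependent_subgaussian ::
  "real \<Rightarrow> real measure set \<Rightarrow> nat \<Rightarrow> real \<Rightarrow> ((nat \<Rightarrow> real) \<times> real \<Rightarrow> real) \<Rightarrow> bool" where
  "delta_dependent_subgaussian L \<P>\<^sub>0 n \<delta>min E \<longleftrightarrow>
     E \<in> borel_measurable
       ((\<Pi>\<^sub>M i\<in>{..<n}. (borel :: real measure)) \<Otimes>\<^sub>M restrict_space borel {\<delta>min..<1}) \<and>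
     (\<forall>P\<in>\<P>\<^sub>0. \<forall>\<delta>\<in>{\<delta>min..<1}.
        \<P>(x in iid_sample P n. \<bar>E (x, \<delta>) - dist_mean P\<bar> > subgaussian_radius L P n \<delta>) \<le> \<delta>)"

definition multiple_delta_subgaussian ::
  "real \<Rightarrow> real measure set \<Rightarrow> nat \<Rightarrow> real \<Rightarrow> ((nat \<Rightarrow> real) \<Rightarrow> real) \<Rightarrow> bool" where
  "multiple_delta_subgaussian L \<P>\<^sub>0 n \<delta>min E \<longleftrightarrow>
     E \<in> borel_measurable (\<Pi>\<^sub>M i\<in>{..<n}. (borel :: real measure)) \<and>
     (\<forall>\<delta>\<in>{\<delta>min..<1}. \<forall>P\<in>\<P>\<^sub>0.
        \<P>(x in iid_sample P n. \<bar>E x - dist_mean P\<bar> > subgaussian_radius L P n \<delta>) \<le> \<delta>)"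

definition L_star :: real where
  "L_star = 4 * sqrt (2 * (1 + 2 * ln 2) * (1 + 62 * ln 3)) * exp (5/2)"

definition delta_min :: "nat \<Rightarrow> nat \<Rightarrow> real" where
  "delta_min n k = 4 * exp (3 - real n / (124 * real k))"

definition k_reg :: "real \<Rightarrow> real \<Rightarrow> real \<Rightarrow> nat" where
  "k_reg C \<alpha> \<eta> = nat \<lceil>C * \<eta> powr (2 * \<alpha> / (\<alpha> - 2))\<rceil>"

end

theory Submission
  imports Defs "HOL-Real_Asymp.Real_Asymp"
begin

text \<open>
If \<open>P\<close> is \<open>k\<close>-regular, cut the sample into \<open>b\<close> blocks of length \<open>q = n div b \<ge> k\<close>.  Each block mean is at most the mean \<open>\<mu>\<close> of \<open>P\<close>
with probability at least \<open>1/3\<close>, and likewise at least \<open>\<mu>\<close>.  Hence the interval between the lower and the upper \<open>1/8\<close>-quantile of the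
\<open>b\<close> block means, which is computed from the data alone, contains \<open>\<mu>\<close> except with probability \<open>2 (9/10)\<^sup>b\<close> (\<open>block_interval_covers\<close>).
By Chebyshev's inequality a block mean is rarely further than \<open>32 \<sigma> / \<surd>q\<close> from \<open>\<mu>\<close>; so, up to probability \<open>(9/10)\<^sup>b\<close>, at most an
eighth of the block means are that far away, and then the interval is short (\<open>block_interval_short\<close>).  A single estimator
for every \<open>\<delta>\<close> comes from all \<open>b \<le> n div k\<close> together: let \<open>m\<close> be the smallest number for which the intervals with index \<open>b \<ge> m\<close> have
a common point, and answer with such a point (\<open>measurable_selection_from_intervals\<close>).  Whenever all intervals from index \<open>m\<^sub>0\<close> on
contain \<open>\<mu>\<close>, then \<open>m \<le> m\<^sub>0\<close> and the answer lies in the \<open>m\<^sub>0\<close>-th interval.  The failure probability is a geometric sum of order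
\<open>(9/10)\<^bsup>m\<^sub>0\<^esup>\<close>, and \<open>m\<^sub>0\<close> of order \<open>1 + ln (1/\<delta>)\<close> gives the claimed radius.

The moment class inherits this estimator because it is regular.  Under the moment bound, the Lyapunov ratio of a sum of \<open>j\<close> centred
variables is at most \<open>\<eta>\<^sup>\<alpha> j\<^bsup>1 - \<alpha>/2\<^esup>\<close>, which is small as soon as \<open>j\<close> is a large multiple of \<open>\<eta>\<^bsup>2\<alpha>/(\<alpha> - 2)\<^esup>\<close>.  If no multiple \<open>C\<close> were large
enough, there would be a triangular array of violators with \<open>C \<rightarrow> \<infinity>\<close>; the central limit theorem \<open>lyapunov_clt\<close> makes the probability of
either side tend to \<open>1/2\<close>, a contradiction (\<open>P_moment_subset_P2_reg\<close>).  The value of \<open>C\<close> is immaterial, so this takes the place of a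
Berry-Esseen bound.

For tiny \<open>\<delta>\<close> an obstruction comes from point masses.  The point mass at \<open>a\<close> lies in the moment class and has standard deviation \<open>0\<close>, which forces the estimator to
answer \<open>a\<close> on the constant sample \<open>(a, \<dots>, a)\<close>.  A law \<open>P\<close> with an atom of mass \<open>q\<close> at \<open>a\<close> produces this sample with probability
\<open>q\<^sup>n\<close>, so \<open>P\<close> refutes the estimator if \<open>q\<^sup>n > \<delta>\<close> and \<open>a\<close> is further from the mean than the radius
(\<open>no_estimator_from_heavy_atom\<close>).  A fair sign, contaminated with mass \<open>q\<close> of order \<open>e\<^bsup>-5L\<^sup>2\<^esup>\<close> at \<open>-3L\<^sup>2\<close>, does this inside the moment
class (\<open>no_delta_dependent_estimator\<close>).

For a multiple-\<open>\<delta>\<close> estimator, compare Bernoulli laws with parameters \<open>p\<close> and \<open>A p\<close>.  At confidence \<open>1/4\<close> the estimator recognises the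
larger mean, so it exceeds \<open>A p / 2\<close> with probability bounded below under the second law.  Changing the measure costs a factor
exponential in \<open>n A p ln A\<close>, so the same happens under the first law with a probability above some \<open>\<delta> = exp (- D n p)\<close>.  At this
level the radius is only of order \<open>L p \<surd>D\<close>, which is below \<open>A p / 2 - p\<close> if \<open>A\<close> is large in terms of \<open>L\<close>
(\<open>no_multiple_delta_estimator_bernoulli\<close>).  The moment class contains the Bernoulli laws with variance at least \<open>\<eta>\<^bsup>-2\<alpha>/(\<alpha> - 2)\<^esup>\<close>, which
is of order \<open>1/k\<close>; so \<open>p\<close> of this order works unless \<open>A p > 1/2\<close>.  In the exceptional case \<open>k\<close> is bounded in terms of \<open>L\<close>, and the
obstruction from point masses applies.
\<close>

section \<open>Independent samples and second moments\<close>

lemma sets_iid_sample: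
  assumes "real_distribution P"
  shows "sets (iid_sample P n) = sets (\<Pi>\<^sub>M i\<in>{..<n}. (borel :: real measure))"
  unfolding iid_sample_def
  using assms by (intro sets_PiM_cong) (auto simp: real_distribution.events_eq_borel)

lemma prob_space_iid_sample: "real_distribution P \<Longrightarrow> prob_space (iid_sample P n)"
  unfolding iid_sample_def by (intro prob_space_PiM) (auto simp: real_distribution_def)

lemma measurable_iid_coordinate:
  assumes "real_distribution P" "i < n"
  shows "(\<lambda>x. x i) \<in> borel_measurable (iid_sample P n)"
  unfolding measurable_cong_sets[OF sets_iid_sample[OF assms(1)] refl]
  using assms(2) by (intro measurable_component_singleton) auto

lemma distr_iid_coordinate:
  assumes "real_distribution P" "i < n"
  shows "distr (iid_sample P n) borel (\<lambda>x. x i) = P"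
proof -
  interpret real_distribution P by fact
  have "distr (iid_sample P n) borel (\<lambda>x. x i) = distr (iid_sample P n) P (\<lambda>x. x i)"
    by (intro distr_cong) auto
  also have "\<dots> = P"
    unfolding iid_sample_def using assms(2) prob_space_axioms
    by (intro distr_PiM_component[where M="\<lambda>_. P"]) auto
  finally show ?thesis .
qed

lemma measurable_iid_sum:
  assumes "real_distribution P"
  shows "(\<lambda>x. \<Sum>i<n. x i) \<in> borel_measurable (iid_sample P n)"
  using measurable_iid_coordinate[OF assms] by (intro borel_measurable_sum) auto

lemma indep_iid_coordinates:
  assumes "real_distribution P"
  shows "prob_space.indep_vars (iid_sample P n) (\<lambda>_. borel) (\<lambda>i x. x i) {..<n}"
proof (cases "n = 0")
  case True
  interpret prob_space "iid_sample P n" by (rule prob_space_iid_sample[OF assms])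
  show ?thesis unfolding indep_vars_def indep_sets_def using True by auto
next
  case False
  interpret prob_space "iid_sample P n" by (rule prob_space_iid_sample[OF assms])
  have "distr (iid_sample P n) (\<Pi>\<^sub>M i\<in>{..<n}. borel) (\<lambda>x. \<lambda>i\<in>{..<n}. x i)
      = distr (iid_sample P n) (iid_sample P n) (\<lambda>x. x)"
    using sets_iid_sample[OF assms, of n]
    by (intro distr_cong) (auto simp: iid_sample_def space_PiM PiE_def extensional_restrict)
  also have "\<dots> = (\<Pi>\<^sub>M i\<in>{..<n}. distr (iid_sample P n) borel (\<lambda>x. x i))"
    by (simp add: distr_id iid_sample_def cong: PiM_cong)
       (intro PiM_cong refl, simp add: distr_iid_coordinate[OF assms, unfolded iid_sample_def])
  finally show ?thesis
    using False measurable_iid_coordinate[OF assms]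
    by (subst indep_vars_iff_distr_eq_PiM') auto
qed

lemma iid_coordinate_transfer:
  fixes g :: "real \<Rightarrow> real"
  assumes P: "real_distribution P" and i: "i < n" and g [measurable]: "g \<in> borel_measurable borel"
  shows "integrable (iid_sample P n) (\<lambda>x. g (x i)) \<longleftrightarrow> integrable P g"
    and "(LINT x|iid_sample P n. g (x i)) = (LINT x|P. g x)"
proof -
  note [measurable] = measurable_iid_coordinate[OF P i]
  show "integrable (iid_sample P n) (\<lambda>x. g (x i)) \<longleftrightarrow> integrable P g"
    by (subst (2) distr_iid_coordinate[OF P i, symmetric]) (simp add: integrable_distr_eq)
  show "(LINT x|iid_sample P n. g (x i)) = (LINT x|P. g x)"
    by (subst (2) distr_iid_coordinate[OF P i, symmetric]) (simp add: integral_distr)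
qed

lemma (in prob_space) indep_vars_second_moment_sum:
  fixes X :: "'i \<Rightarrow> 'a \<Rightarrow> real"
  assumes "finite I" "indep_vars (\<lambda>_. borel) X I"
    and "\<And>i. i \<in> I \<Longrightarrow> integrable M (\<lambda>x. (X i x)\<^sup>2)"
    and "\<And>i. i \<in> I \<Longrightarrow> expectation (X i) = 0"
  shows "integrable M (\<lambda>x. (\<Sum>i\<in>I. X i x)\<^sup>2) \<and>
    expectation (\<lambda>x. (\<Sum>i\<in>I. X i x)\<^sup>2) = (\<Sum>i\<in>I. expectation (\<lambda>x. (X i x)\<^sup>2))"
  using assms
proof (induction I rule: finite_induct)
  case empty
  then show ?case by simp
next
  case (insert a I)
  have ind: "indep_vars (\<lambda>_. borel) X I"
    using insert.prems(1) by (rule indep_vars_subset) auto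
  have rv: "random_variable borel (X i)" if "i \<in> insert a I" for i
    using insert.prems(1) that by (auto simp: indep_vars_def)
  have int: "integrable M (X i)" if "i \<in> insert a I" for i
    using square_integrable_imp_integrable[OF rv[OF that] insert.prems(2)[OF that]] .
  have IH: "integrable M (\<lambda>x. (\<Sum>i\<in>I. X i x)\<^sup>2)"
    "expectation (\<lambda>x. (\<Sum>i\<in>I. X i x)\<^sup>2) = (\<Sum>i\<in>I. expectation (\<lambda>x. (X i x)\<^sup>2))"
    using insert.IH[OF ind] insert.prems by auto
  have intS: "integrable M (\<lambda>x. \<Sum>i\<in>I. X i x)"
    using int by auto
  have var: "indep_var borel (X a) borel (\<lambda>x. \<Sum>i\<in>I. X i x)"
    using insert.hyps insert.prems(1) by (intro indep_vars_sum) auto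
  have prod: "integrable M (\<lambda>x. X a x * (\<Sum>i\<in>I. X i x))"
    using indep_var_integrable[OF var int[OF insertI1] intS] .
  have "expectation (\<lambda>x. X a x * (\<Sum>i\<in>I. X i x)) = expectation (X a) * expectation (\<lambda>x. \<Sum>i\<in>I. X i x)"
    by (rule indep_var_lebesgue_integral[OF var int[OF insertI1] intS])
  then have 0: "expectation (\<lambda>x. X a x * (\<Sum>i\<in>I. X i x)) = 0"
    using insert.prems(3) by simp
  have eq: "(\<Sum>i\<in>insert a I. X i x)\<^sup>2 = (X a x)\<^sup>2 + 2 * (X a x * (\<Sum>i\<in>I. X i x)) + (\<Sum>i\<in>I. X i x)\<^sup>2" for x
    using insert.hyps by (simp add: power2_sum)
  show ?case
    unfolding eq using insert.hyps insert.prems(2) IH prod 0 by simp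
qed

lemma P2_properties:
  assumes "P \<in> P2"
  shows "real_distribution P" "integrable P (\<lambda>x. x)" "integrable P (\<lambda>x. x\<^sup>2)"
    "integrable P (\<lambda>x. (x - dist_mean P)\<^sup>2)" "(LINT x|P. x - dist_mean P) = 0"
    "(LINT x|P. (x - dist_mean P)\<^sup>2) = (dist_sd P)\<^sup>2" "dist_sd P \<ge> 0"
proof -
  show P: "real_distribution P" and sq: "integrable P (\<lambda>x. x\<^sup>2)" using assms by (auto simp: P2_def)
  interpret real_distribution P by fact
  show i: "integrable P (\<lambda>x. x)" by (rule square_integrable_imp_integrable[OF _ sq]) simp
  show "integrable P (\<lambda>x. (x - dist_mean P)\<^sup>2)"
    using i sq by (auto simp: power2_diff)
  show "(LINT x|P. x - dist_mean P) = 0"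
    using i by (simp add: dist_mean_def prob_space[unfolded space_eq_univ])
  show "(LINT x|P. (x - dist_mean P)\<^sup>2) = (dist_sd P)\<^sup>2" "dist_sd P \<ge> 0"
    by (simp_all add: dist_sd_def dist_mean_def)
qed

lemma zero_sd_imp_AE_eq_mean:
  assumes "P \<in> P2" "dist_sd P = 0"
  shows "AE x in P. x = dist_mean P"
proof -
  note P = P2_properties[OF assms(1)]
  have "AE x in P. (x - dist_mean P)\<^sup>2 = 0"
    using P(4,6) assms(2) by (subst integral_nonneg_eq_0_iff_AE[symmetric]) auto
  then show ?thesis by eventually_elim auto
qed

section \<open>A central limit theorem for triangular arrays\<close>

text \<open>The remainder of the second-order expansion of a characteristic function is a minimum of a quadratic and a
  cubic term; interpolating between the two exponents leaves a moment of order \<open>\<alpha>\<close>.\<close>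

lemma lyapunov_truncation:
  fixes t x \<alpha> :: real
  assumes "2 \<le> \<alpha>" "\<alpha> \<le> 3"
  shows "min (6 * x\<^sup>2) (\<bar>t\<bar> * \<bar>x\<bar> ^ 3) \<le> 6 * \<bar>t\<bar> powr (\<alpha> - 2) * \<bar>x\<bar> powr \<alpha>"
proof (cases "t = 0 \<or> x = 0")
  case True
  then show ?thesis by auto
next
  case False
  then have p: "\<bar>t\<bar> > 0" "\<bar>x\<bar> > 0" by auto
  have x2: "\<bar>x\<bar> powr \<alpha> = x\<^sup>2 * \<bar>x\<bar> powr (\<alpha> - 2)"
    using p powr_add[of "\<bar>x\<bar>" 2 "\<alpha> - 2"] by (simp add: powr_numeral)
  have eq: "6 * \<bar>t\<bar> powr (\<alpha> - 2) * \<bar>x\<bar> powr \<alpha> = 6 * x\<^sup>2 * \<bar>t * x\<bar> powr (\<alpha> - 2)"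
    using p by (simp add: x2 abs_mult powr_mult)
  show ?thesis
  proof (cases "\<bar>t * x\<bar> \<ge> 1")
    case True
    then have "1 \<le> \<bar>t * x\<bar> powr (\<alpha> - 2)" using assms by (intro ge_one_powr_ge_zero) auto
    then have "6 * x\<^sup>2 * 1 \<le> 6 * x\<^sup>2 * \<bar>t * x\<bar> powr (\<alpha> - 2)" by (intro mult_left_mono) auto
    then show ?thesis unfolding eq by linarith
  next
    case False
    then have "\<bar>t * x\<bar> powr 1 \<le> \<bar>t * x\<bar> powr (\<alpha> - 2)"
      using assms p by (intro powr_mono') auto
    then have "x\<^sup>2 * \<bar>t * x\<bar> \<le> x\<^sup>2 * \<bar>t * x\<bar> powr (\<alpha> - 2)"
      using p by (intro mult_left_mono) auto
    moreover have "\<bar>t\<bar> * \<bar>x\<bar> ^ 3 = x\<^sup>2 * \<bar>t * x\<bar>"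
      by (simp add: abs_mult power3_eq_cube power2_eq_square mult_ac)
    moreover have "0 \<le> x\<^sup>2 * \<bar>t * x\<bar> powr (\<alpha> - 2)" by simp
    ultimately show ?thesis unfolding eq by linarith
  qed
qed

text \<open>Both bases have modulus at most \<open>1\<close> (this is where \<open>t\<^sup>2 / 4 \<le> j\<close> enters), so the difference of the \<open>j\<close>-th powers is
  at most \<open>j\<close> times the difference of the bases.  The bound on the right is the Lyapunov ratio, up to a factor that depends on \<open>t\<close>.\<close>

lemma char_iid_sum_approx:
  assumes P: "P \<in> P2" and j: "real j \<ge> t\<^sup>2 / 4" "j > 0" and s: "dist_sd P > 0" and \<alpha>: "2 \<le> \<alpha>" "\<alpha> \<le> 3"
    and int: "integrable P (\<lambda>x. \<bar>x - dist_mean P\<bar> powr \<alpha>)"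
  shows "cmod (char (distr (iid_sample P j) borel
            (\<lambda>x. \<Sum>i<j. (x i - dist_mean P) / (dist_sd P * sqrt (real j)))) t
           - of_real ((1 + (- t\<^sup>2 / 2) / real j) ^ j))
      \<le> t\<^sup>2 * \<bar>t\<bar> powr (\<alpha> - 2) * (LINT x|P. \<bar>x - dist_mean P\<bar> powr \<alpha>) /
           (dist_sd P powr \<alpha> * real j powr (\<alpha> / 2 - 1))"
proof -
  note D = P2_properties[OF P]
  interpret P: real_distribution P by (rule D)
  interpret I: prob_space "iid_sample P j" by (rule prob_space_iid_sample[OF D(1)])
  define \<mu> where "\<mu> = dist_mean P"
  define \<sigma> where "\<sigma> = dist_sd P"
  define \<phi> where "\<phi> = char (distr P borel (\<lambda>x. (x - \<mu>) / (\<sigma> * sqrt (real j)))) t"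
  define u where "u = t / (\<sigma> * sqrt (real j))"
  have \<sigma>: "\<sigma> > 0" using s by (simp add: \<sigma>_def)
  have comp: "distr (iid_sample P j) borel (\<lambda>x. (x i - \<mu>) / (\<sigma> * sqrt (real j)))
      = distr P borel (\<lambda>x. (x - \<mu>) / (\<sigma> * sqrt (real j)))" if "i < j" for i
    using distr_distr[of "\<lambda>x. (x - \<mu>) / (\<sigma> * sqrt (real j))" borel borel "\<lambda>x. x i" "iid_sample P j"]
      measurable_iid_coordinate[OF D(1) that]
    by (simp add: distr_iid_coordinate[OF D(1) that] comp_def)
  have ind: "I.indep_vars (\<lambda>_. borel) (\<lambda>i x. (x i - \<mu>) / (\<sigma> * sqrt (real j))) {..<j}"
    by (rule I.indep_vars_compose2[OF indep_iid_coordinates[OF D(1)]]) measurable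
  have char: "char (distr (iid_sample P j) borel (\<lambda>x. \<Sum>i<j. (x i - \<mu>) / (\<sigma> * sqrt (real j)))) t = \<phi> ^ j"
    unfolding I.char_distr_sum[OF ind] by (simp add: comp \<phi>_def)
  have \<phi>': "\<phi> = char (distr P borel (\<lambda>x. x - \<mu>)) u"
    unfolding \<phi>_def char_def u_def by (subst (1 2) integral_distr) (auto simp: mult_ac)
  have "cmod (\<phi> - (1 - u\<^sup>2 * \<sigma>\<^sup>2 / 2)) \<le>
      (u\<^sup>2 / 6) * (LINT x|P. min (6 * (x - \<mu>)\<^sup>2) (\<bar>u\<bar> * \<bar>x - \<mu>\<bar> ^ 3))"
    unfolding \<phi>'
  proof (rule P.char_approx3'[OF _ _ _ _ _ refl])
    have 0: "(LINT x|P. x - \<mu>) = 0" using D(5) by (simp add: \<mu>_def)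
    then show "(LINT x|P. x - \<mu>) = 0" .
    show "(LINT x|P. (x - \<mu> - (LINT x|P. x - \<mu>))\<^sup>2) = \<sigma>\<^sup>2"
      unfolding 0 using D(6) by (simp add: \<mu>_def \<sigma>_def)
    show "integrable P (\<lambda>x. x - \<mu>)" using D(2) by simp
    show "integrable P (\<lambda>x. (x - \<mu>)\<^sup>2)" using D(4) by (simp add: \<mu>_def)
  qed simp
  also have "\<dots> \<le> (u\<^sup>2 / 6) * (LINT x|P. 6 * \<bar>u\<bar> powr (\<alpha> - 2) * \<bar>x - \<mu>\<bar> powr \<alpha>)"
  proof (intro mult_left_mono integral_mono)
    show "integrable P (\<lambda>x. min (6 * (x - \<mu>)\<^sup>2) (\<bar>u\<bar> * \<bar>x - \<mu>\<bar> ^ 3))"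
      by (rule Bochner_Integration.integrable_bound[where f="\<lambda>x. 6 * (x - dist_mean P)\<^sup>2"])
         (use D(4) in \<open>auto simp: \<mu>_def\<close>)
    show "integrable P (\<lambda>x. 6 * \<bar>u\<bar> powr (\<alpha> - 2) * \<bar>x - \<mu>\<bar> powr \<alpha>)"
      using int by (simp add: \<mu>_def)
  qed (use lyapunov_truncation[OF \<alpha>] in auto)
  also have "\<dots> = u\<^sup>2 * \<bar>u\<bar> powr (\<alpha> - 2) * (LINT x|P. \<bar>x - \<mu>\<bar> powr \<alpha>)"
    by simp
  finally have 1: "cmod (\<phi> - (1 - u\<^sup>2 * \<sigma>\<^sup>2 / 2)) \<le> u\<^sup>2 * \<bar>u\<bar> powr (\<alpha> - 2) * (LINT x|P. \<bar>x - \<mu>\<bar> powr \<alpha>)" .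
  have u2: "u\<^sup>2 = t\<^sup>2 / (\<sigma>\<^sup>2 * real j)" using \<sigma> j by (simp add: u_def power_divide power_mult_distrib)
  have ups: "real j * (u\<^sup>2 * \<bar>u\<bar> powr (\<alpha> - 2)) = t\<^sup>2 * \<bar>t\<bar> powr (\<alpha> - 2) / (\<sigma> powr \<alpha> * real j powr (\<alpha> / 2 - 1))"
  proof -
    have "\<sigma> powr \<alpha> = \<sigma>\<^sup>2 * \<sigma> powr (\<alpha> - 2)"
      using \<sigma> powr_add[of \<sigma> 2 "\<alpha> - 2"] by (simp add: powr_numeral)
    moreover have "sqrt (real j) powr (\<alpha> - 2) = real j powr (\<alpha> / 2 - 1)"
      using j by (simp add: powr_half_sqrt[symmetric] powr_powr diff_divide_distrib)
    moreover have "\<bar>u\<bar> powr (\<alpha> - 2) = \<bar>t\<bar> powr (\<alpha> - 2) / (\<sigma> powr (\<alpha> - 2) * sqrt (real j) powr (\<alpha> - 2))"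
      using \<sigma> j by (simp add: u_def abs_divide abs_mult powr_divide powr_mult)
    ultimately show ?thesis using \<sigma> j by (simp add: u2 field_simps)
  qed
  have 2: "1 - u\<^sup>2 * \<sigma>\<^sup>2 / 2 = 1 + (- t\<^sup>2 / 2) / real j"
    using \<sigma> j by (simp add: u2)
  have "cmod (\<phi> ^ j - (of_real (1 + (- t\<^sup>2 / 2) / real j)) ^ j) \<le> real j * cmod (\<phi> - of_real (1 + (- t\<^sup>2 / 2) / real j))"
  proof (rule norm_power_diff)
    interpret Y: real_distribution "distr P borel (\<lambda>x. x - \<mu>)"
      by (rule P.real_distribution_distr) simp
    show "cmod \<phi> \<le> 1" unfolding \<phi>' by (rule Y.cmod_char_le_1)
    have "\<bar>1 + (- t\<^sup>2 / 2) / real j\<bar> \<le> 1" using j by (auto simp: abs_le_iff field_simps)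
    then show "cmod (of_real (1 + (- t\<^sup>2 / 2) / real j)) \<le> 1" by (simp only: norm_of_real)
  qed
  also have "\<dots> \<le> real j * (u\<^sup>2 * \<bar>u\<bar> powr (\<alpha> - 2) * (LINT x|P. \<bar>x - \<mu>\<bar> powr \<alpha>))"
    using 1 unfolding 2[symmetric] by (intro mult_left_mono) auto
  also have "\<dots> = t\<^sup>2 * \<bar>t\<bar> powr (\<alpha> - 2) * (LINT x|P. \<bar>x - \<mu>\<bar> powr \<alpha>) / (\<sigma> powr \<alpha> * real j powr (\<alpha> / 2 - 1))"
    unfolding mult.assoc[symmetric, of "real j"] ups[unfolded mult.assoc[symmetric, of "real j"]] by simp
  finally show ?thesis using char by (simp add: \<mu>_def \<sigma>_def)
qed

text \<open>Sample size and law vary together, so a limit theorem for one fixed law does not suffice.  The characteristic functions converge by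
  the quantitative estimate above, and Levy's continuity theorem does the rest.\<close>

theorem lyapunov_clt:
  fixes P :: "nat \<Rightarrow> real measure" and j :: "nat \<Rightarrow> nat"
  assumes \<alpha>: "2 \<le> \<alpha>" "\<alpha> \<le> 3"
    and P: "\<And>m. P m \<in> P2" "\<And>m. dist_sd (P m) > 0"
    and int: "\<And>m. integrable (P m) (\<lambda>x. \<bar>x - dist_mean (P m)\<bar> powr \<alpha>)"
    and j: "filterlim j at_top sequentially"
    and ratio: "(\<lambda>m. (LINT x|P m. \<bar>x - dist_mean (P m)\<bar> powr \<alpha>) /
           (dist_sd (P m) powr \<alpha> * real (j m) powr (\<alpha> / 2 - 1))) \<longlonglongrightarrow> 0"
  shows "weak_conv_m (\<lambda>m. distr (iid_sample (P m) (j m)) borel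
            (\<lambda>x. \<Sum>i<j m. (x i - dist_mean (P m)) / (dist_sd (P m) * sqrt (real (j m))))) std_normal_distribution"
proof (rule levy_continuity)
  let ?D = "\<lambda>m. distr (iid_sample (P m) (j m)) borel
            (\<lambda>x. \<Sum>i<j m. (x i - dist_mean (P m)) / (dist_sd (P m) * sqrt (real (j m))))"
  show "real_distribution (?D m)" for m
    using P2_properties(1)[OF P(1)] measurable_iid_coordinate[of "P m"]
    by (intro prob_space.real_distribution_distr prob_space_iid_sample borel_measurable_sum) auto
  show "real_distribution std_normal_distribution" by (rule real_dist_normal_dist)
  fix t :: real
  let ?e = "\<lambda>m. of_real ((1 + (- t\<^sup>2 / 2) / real (j m)) ^ j m) :: complex"
  have "(\<lambda>m. (1 + (- t\<^sup>2 / 2) / real (j m)) ^ j m) \<longlonglongrightarrow> exp (- t\<^sup>2 / 2)"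
    using filterlim_compose[OF tendsto_exp_limit_sequentially[of "- t\<^sup>2 / 2"] j] .
  then have e: "?e \<longlonglongrightarrow> of_real (exp (- t\<^sup>2 / 2))" by (rule tendsto_of_real)
  have ev: "eventually (\<lambda>m. cmod (char (?D m) t - ?e m) \<le> t\<^sup>2 * \<bar>t\<bar> powr (\<alpha> - 2) * ((LINT x|P m. \<bar>x - dist_mean (P m)\<bar> powr \<alpha>) /
           (dist_sd (P m) powr \<alpha> * real (j m) powr (\<alpha> / 2 - 1)))) sequentially"
  proof -
    have "eventually (\<lambda>m. j m \<ge> max 1 (nat \<lceil>t\<^sup>2 / 4\<rceil>)) sequentially"
      using j unfolding filterlim_at_top by blast
    then show ?thesis
    proof eventually_elim
      case (elim m)
      then have "real (j m) \<ge> t\<^sup>2 / 4" "j m > 0" using nat_ceiling_le_eq[of "t\<^sup>2 / 4" "j m"] by linarith+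
      from char_iid_sum_approx[OF P(1) this P(2) \<alpha> int] show ?case by simp
    qed
  qed
  have "(\<lambda>m. char (?D m) t - ?e m) \<longlonglongrightarrow> 0"
    by (rule Lim_null_comparison[OF ev]) (rule tendsto_mult_right_zero[OF ratio])
  from tendsto_add[OF this e] show "(\<lambda>m. char (?D m) t) \<longlonglongrightarrow> char std_normal_distribution t"
    by (simp add: char_std_normal_distribution)
qed

lemma std_normal_singleton: "measure std_normal_distribution {x} = 0"
  by (simp add: measure_def emeasure_density nn_integral_null_set null_setsI)

text \<open>The density is even and there is no atom at \<open>0\<close>.\<close>

lemma cdf_std_normal_0: "cdf std_normal_distribution 0 = 1/2"
proof -
  interpret N: real_distribution std_normal_distribution by (rule real_dist_normal_dist)
  have "emeasure std_normal_distribution {..0} = (\<integral>\<^sup>+x. ennreal (std_normal_density x) * indicator {..0} x \<partial>lborel)"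
    by (simp add: emeasure_density)
  also have "\<dots> = (\<integral>\<^sup>+x. ennreal (std_normal_density x) * indicator {0..} x \<partial>lborel)"
    by (subst nn_integral_real_affine[where c="-1" and t=0])
       (auto simp: std_normal_density_def one_ennreal_def[symmetric] intro!: nn_integral_cong split: split_indicator)
  also have "\<dots> = emeasure std_normal_distribution {0..}"
    by (simp add: emeasure_density)
  finally have "N.prob {..0} = N.prob {0..}" by (simp add: measure_def)
  moreover have "N.prob {0..} = N.prob {0} + N.prob {0<..}"
    by (subst N.finite_measure_Union[symmetric]) (auto intro!: arg_cong[where f=N.prob])
  moreover have "N.prob {0<..} = 1 - N.prob {..0}"
    using N.prob_compl[of "{..0}"] by (simp add: Compl_eq_Diff_UNIV[symmetric] Compl_atMost)
  ultimately show ?thesis by (simp add: cdf_def std_normal_singleton)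
qed

section \<open>Bounded moment ratio implies regularity\<close>

lemma iid_sample_degenerate:
  assumes "P \<in> P2" "dist_sd P = 0"
  shows "AE x in iid_sample P n. \<forall>i<n. x i = dist_mean P"
proof -
  have "AE x in iid_sample P n. x i = dist_mean P" if "i < n" for i
    unfolding iid_sample_def
    using that zero_sd_imp_AE_eq_mean[OF assms] P2_properties(1)[OF assms(1)]
    by (intro AE_PiM_component) (auto simp: real_distribution_def)
  then show ?thesis by (auto simp: AE_all_countable intro!: AE_impI)
qed

text \<open>Standardising is impossible here, but a sample from a point mass has sum exactly equal to its mean.\<close>

lemma degenerate_in_P2_reg:
  assumes "P \<in> P2" "dist_sd P = 0"
  shows "P \<in> P2_reg k"
proof -
  have "p_plus P j = 1 \<and> p_minus P j = 1" for j
  proof -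
    interpret prob_space "iid_sample P j" using P2_properties(1)[OF assms(1)] by (rule prob_space_iid_sample)
    note [measurable] = measurable_iid_sum[OF P2_properties(1)[OF assms(1)]]
    have *: "AE x in iid_sample P j. (\<Sum>i<j. x i) = real j * dist_mean P"
      using iid_sample_degenerate[OF assms, of j] by eventually_elim simp
    show ?thesis unfolding p_plus_def p_minus_def
      by (intro conjI prob_eq_1[THEN iffD2]) (use * in \<open>auto elim: eventually_mono\<close>)
  qed
  then show ?thesis using assms(1) by (auto simp: P2_reg_def)
qed

text \<open>Translates the two regularity probabilities into the distribution function of the standardised sum at \<open>0\<close>; the second is
  only an inequality because it ignores the event that the sum equals its mean.\<close>

lemma p_bounds_by_cdf:
  assumes P: "P \<in> P2" and s: "dist_sd P > 0" and j: "j > 0"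
  defines "F \<equiv> cdf (distr (iid_sample P j) borel
            (\<lambda>x. \<Sum>i<j. (x i - dist_mean P) / (dist_sd P * sqrt (real j))))"
  shows "p_minus P j = F 0" "p_plus P j \<ge> 1 - F 0"
proof -
  note R = P2_properties(1)[OF P]
  interpret prob_space "iid_sample P j" using R by (rule prob_space_iid_sample)
  note [measurable] = measurable_iid_sum[OF R]
  let ?Z = "\<lambda>x. \<Sum>i<j. (x i - dist_mean P) / (dist_sd P * sqrt (real j))"
  have Z: "?Z x = ((\<Sum>i<j. x i) - real j * dist_mean P) / (dist_sd P * sqrt (real j))" for x
    by (simp add: sum_divide_distrib[symmetric] sum_subtractf)
  have F: "F 0 = \<P>(x in iid_sample P j. ?Z x \<le> 0)"
    unfolding F_def cdf_def by (subst measure_distr) (auto simp: Z vimage_def Int_def intro!: arg_cong[where f=prob])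
  have le: "?Z x \<le> 0 \<longleftrightarrow> (\<Sum>i<j. x i) \<le> real j * dist_mean P" for x
  proof -
    have "dist_sd P * sqrt (real j) > 0" using s j by simp
    then show ?thesis unfolding Z by (simp add: divide_le_0_iff not_le[symmetric])
  qed
  show 1: "p_minus P j = F 0" unfolding F le p_minus_def ..
  have "1 - F 0 = \<P>(x in iid_sample P j. \<not> (\<Sum>i<j. x i) \<le> real j * dist_mean P)"
    unfolding 1[symmetric] p_minus_def by (subst prob_neg) auto
  also have "\<dots> \<le> p_plus P j"
    unfolding p_plus_def by (intro finite_measure_mono) auto
  finally show "p_plus P j \<ge> 1 - F 0" .
qed

lemma k_reg_ge: "real (k_reg C \<alpha> \<eta>) \<ge> C * \<eta> powr (2 * \<alpha> / (\<alpha> - 2))"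
  unfolding k_reg_def by linarith

lemma k_reg_le: "C > 0 \<Longrightarrow> real (k_reg C \<alpha> \<eta>) \<le> C * \<eta> powr (2 * \<alpha> / (\<alpha> - 2)) + 1"
proof -
  assume "C > 0"
  then have "C * \<eta> powr (2 * \<alpha> / (\<alpha> - 2)) \<ge> 0" by simp
  then show ?thesis unfolding k_reg_def by linarith
qed

text \<open>The constant comes from a contradiction: a sequence of violators for \<open>C = 1, 2, 3, \<dots>\<close> has Lyapunov ratio tending to \<open>0\<close>, so
  its standardised sums are asymptotically normal and both probabilities tend to \<open>1/2 > 1/3\<close>.\<close>

theorem P_moment_subset_P2_reg:
  assumes \<alpha>: "2 < \<alpha>" "\<alpha> \<le> 3"
  shows "\<exists>C>0. \<forall>\<eta>\<ge>1. P_moment \<alpha> \<eta> \<subseteq> P2_reg (k_reg C \<alpha> \<eta>)"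
proof (rule ccontr)
  assume "\<not> ?thesis"
  then have neg: "\<exists>\<eta> P. \<eta> \<ge> 1 \<and> P \<in> P_moment \<alpha> \<eta> \<and> P \<notin> P2_reg (k_reg (real (Suc m)) \<alpha> \<eta>)" for m
    by (metis of_nat_0_less_iff subsetI zero_less_Suc)
  have "\<exists>\<eta> P j. \<eta> \<ge> 1 \<and> P \<in> P_moment \<alpha> \<eta> \<and> dist_sd P > 0 \<and> j \<ge> k_reg (real (Suc m)) \<alpha> \<eta> \<and>
     min (p_plus P j) (p_minus P j) < 1/3" for m
  proof -
    from neg[of m] obtain \<eta> P where *: "\<eta> \<ge> 1" "P \<in> P_moment \<alpha> \<eta>" "P \<notin> P2_reg (k_reg (real (Suc m)) \<alpha> \<eta>)" by blast
    then have "P \<in> P2" by (simp add: P_moment_def)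
    moreover have "dist_sd P > 0"
      using degenerate_in_P2_reg[OF \<open>P \<in> P2\<close>] P2_properties(7)[OF \<open>P \<in> P2\<close>] *(3) by force
    moreover obtain j where "j \<ge> k_reg (real (Suc m)) \<alpha> \<eta>" "\<not> 1/3 \<le> min (p_plus P j) (p_minus P j)"
      using *(3) \<open>P \<in> P2\<close> unfolding P2_reg_def by blast
    ultimately show ?thesis using * by (intro exI[of _ \<eta>] exI[of _ P] exI[of _ j]) auto
  qed
  then obtain \<eta> P j where H: "\<And>m. \<eta> m \<ge> 1" "\<And>m. P m \<in> P_moment \<alpha> (\<eta> m)" "\<And>m. dist_sd (P m) > 0"
     "\<And>m. j m \<ge> k_reg (real (Suc m)) \<alpha> (\<eta> m)" "\<And>m. min (p_plus (P m) (j m)) (p_minus (P m) (j m)) < 1/3"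
    by metis
  have P2: "P m \<in> P2" and mom: "integrable (P m) (\<lambda>x. \<bar>x - dist_mean (P m)\<bar> powr \<alpha>)"
    "(LINT x|P m. \<bar>x - dist_mean (P m)\<bar> powr \<alpha>) \<le> (\<eta> m * dist_sd (P m)) powr \<alpha>" for m
    using H(2)[of m] by (auto simp: P_moment_def)
  have jge: "real (j m) \<ge> real (Suc m) * \<eta> m powr (2 * \<alpha> / (\<alpha> - 2))" for m
    using k_reg_ge[of "real (Suc m)" "\<eta> m" \<alpha>] H(4)[of m] by linarith
  have jge': "j m \<ge> m" and jpos: "j m > 0" for m
  proof -
    have "\<eta> m powr (2 * \<alpha> / (\<alpha> - 2)) \<ge> 1" using H(1)[of m] \<alpha> by (intro ge_one_powr_ge_zero) auto
    then have "real (Suc m) * 1 \<le> real (Suc m) * \<eta> m powr (2 * \<alpha> / (\<alpha> - 2))" by (intro mult_left_mono) auto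
    from order_trans[OF this jge] have "real (Suc m) \<le> real (j m)" by simp
    then show "j m \<ge> m" "j m > 0" by linarith+
  qed
  have j: "filterlim j at_top sequentially"
    using jge' by (intro filterlim_at_top_mono[OF filterlim_ident]) auto
  let ?\<rho> = "\<lambda>m. (LINT x|P m. \<bar>x - dist_mean (P m)\<bar> powr \<alpha>) /
           (dist_sd (P m) powr \<alpha> * real (j m) powr (\<alpha> / 2 - 1))"
  have \<rho>: "?\<rho> m \<le> real (Suc m) powr (-(\<alpha> / 2 - 1))" for m
  proof -
    have "real (Suc m) powr (\<alpha> / 2 - 1) * \<eta> m powr \<alpha> = (real (Suc m) * \<eta> m powr (2 * \<alpha> / (\<alpha> - 2))) powr (\<alpha> / 2 - 1)"
    proof -
      have "2 * \<alpha> / (\<alpha> - 2) * (\<alpha> / 2 - 1) = \<alpha>" using \<alpha> by (simp add: field_simps)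
      then have "(\<eta> m powr (2 * \<alpha> / (\<alpha> - 2))) powr (\<alpha> / 2 - 1) = \<eta> m powr \<alpha>"
        by (simp only: powr_powr)
      then show ?thesis by (subst powr_mult) auto
    qed
    also have "\<dots> \<le> real (j m) powr (\<alpha> / 2 - 1)"
      using jge[of m] \<alpha> by (intro powr_mono2) auto
    finally have 1: "real (Suc m) powr (\<alpha> / 2 - 1) * \<eta> m powr \<alpha> \<le> real (j m) powr (\<alpha> / 2 - 1)" .
    have "?\<rho> m \<le> (\<eta> m * dist_sd (P m)) powr \<alpha> / (dist_sd (P m) powr \<alpha> * real (j m) powr (\<alpha> / 2 - 1))"
      by (intro divide_right_mono mom(2)) simp
    also have "\<dots> = \<eta> m powr \<alpha> / real (j m) powr (\<alpha> / 2 - 1)"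
      using H(1)[of m] H(3)[of m] by (subst powr_mult) auto
    also have "\<dots> \<le> \<eta> m powr \<alpha> / (real (Suc m) powr (\<alpha> / 2 - 1) * \<eta> m powr \<alpha>)"
      using 1 H(1)[of m] jpos[of m] by (intro divide_left_mono mult_pos_pos) auto
    also have "\<dots> = real (Suc m) powr (-(\<alpha> / 2 - 1))"
    proof -
      have cancel: "a / (b * a) = inverse b" if "a > 0" for a b :: real
        using that by (simp add: field_simps)
      show ?thesis using H(1)[of m] by (subst cancel) (auto simp only: powr_minus powr_gt_zero)
    qed
    finally show ?thesis .
  qed
  have lim: "(\<lambda>m. real (Suc m) powr (-(\<alpha> / 2 - 1))) \<longlonglongrightarrow> 0"
    using \<alpha> by (intro tendsto_neg_powr filterlim_compose[OF filterlim_real_sequentially filterlim_Suc]) auto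
  have ratio: "?\<rho> \<longlonglongrightarrow> 0"
  proof (rule tendsto_sandwich[OF _ _ tendsto_const lim])
    show "\<forall>\<^sub>F m in sequentially. 0 \<le> ?\<rho> m"
      by (intro always_eventually allI divide_nonneg_nonneg Bochner_Integration.integral_nonneg) auto
    show "\<forall>\<^sub>F m in sequentially. ?\<rho> m \<le> real (Suc m) powr (-(\<alpha> / 2 - 1))"
      using \<rho> by (intro always_eventually allI)
  qed
  let ?F = "\<lambda>m. cdf (distr (iid_sample (P m) (j m)) borel
            (\<lambda>x. \<Sum>i<j m. (x i - dist_mean (P m)) / (dist_sd (P m) * sqrt (real (j m)))))"
  interpret N: real_distribution std_normal_distribution by (rule real_dist_normal_dist)
  have "(\<lambda>m. ?F m 0) \<longlonglongrightarrow> cdf std_normal_distribution 0"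
  proof -
    have "isCont (cdf std_normal_distribution) 0" by (simp add: N.isCont_cdf std_normal_singleton)
    then show ?thesis
      using lyapunov_clt[of \<alpha> P j, OF _ _ P2 H(3) mom(1) j ratio] \<alpha>
      unfolding weak_conv_m_def weak_conv_def by simp
  qed
  then have "(\<lambda>m. ?F m 0) \<longlonglongrightarrow> 1/2" by (simp add: cdf_std_normal_0)
  then have "eventually (\<lambda>m. ?F m 0 > 1/3 \<and> ?F m 0 < 2/3) sequentially"
    by (intro eventually_conj order_tendstoD) auto
  then obtain m where "?F m 0 > 1/3" "?F m 0 < 2/3" by (auto dest: eventually_happens)
  moreover have "p_minus (P m) (j m) = ?F m 0" "p_plus (P m) (j m) \<ge> 1 - ?F m 0"
    using p_bounds_by_cdf[OF P2 H(3) jpos, of m] by auto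
  ultimately show False using H(5)[of m] by linarith
qed

section \<open>Block means and counting inequalities\<close>

text \<open>Markov's inequality for \<open>u\<^bsup>8N\<^esup>\<close>, where \<open>N\<close> counts the indices that fall into \<open>A\<close>; by independence its expectation is a
  product.  With \<open>u < 1\<close> this bounds the probability that at most an eighth of the indices are hit, with \<open>u > 1\<close> that at
  least an eighth are.  The eighth power keeps everything rational.\<close>

lemma (in prob_space) indep_count_tail:
  fixes Y :: "nat \<Rightarrow> 'a \<Rightarrow> real"
  assumes ind: "indep_vars (\<lambda>_. borel) Y {..<b}" and A [measurable]: "A \<in> sets borel"
    and u: "u > 0" and \<rho>: "\<And>i. i < b \<Longrightarrow> 1 + (u ^ 8 - 1) * prob {x \<in> space M. Y i x \<in> A} \<le> \<rho> * u"
  defines "S \<equiv> {x \<in> space M. u ^ b \<le> u ^ (8 * card {i \<in> {..<b}. Y i x \<in> A})}"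
  shows "S \<in> events" "prob S \<le> \<rho> ^ b"
proof -
  define W where "W i x = (if Y i x \<in> A then u ^ 8 else 1)" for i x
  have rv [measurable]: "random_variable borel (Y i)" if "i \<in> {..<b}" for i
    using ind that by (auto simp: indep_vars_def)
  have W_meas: "random_variable borel (W i)" if "i \<in> {..<b}" for i
    using that unfolding W_def by measurable
  have W_ind: "indep_vars (\<lambda>_. borel) W {..<b}"
    unfolding W_def by (rule indep_vars_compose2[OF ind]) measurable
  have W_int: "integrable M (W i)" if "i \<in> {..<b}" for i
    using W_meas[OF that] by (rule integrable_const_bound[where B="max (u ^ 8) 1", rotated])
      (use u in \<open>auto simp: W_def\<close>)
  have W_exp: "expectation (W i) = 1 + (u ^ 8 - 1) * prob {x \<in> space M. Y i x \<in> A}" if "i \<in> {..<b}" for i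
  proof -
    have s: "{x \<in> space M. Y i x \<in> A} \<in> events" using that by measurable
    have "expectation (W i) = expectation (\<lambda>x. 1 + (u ^ 8 - 1) * indicator {x \<in> space M. Y i x \<in> A} x)"
      by (intro Bochner_Integration.integral_cong) (auto simp: W_def)
    also have "\<dots> = 1 + (u ^ 8 - 1) * prob {x \<in> space M. Y i x \<in> A}"
      using s by (subst Bochner_Integration.integral_add) (auto simp: prob_space emeasure_eq_measure)
    finally show ?thesis .
  qed
  have prod: "(\<Prod>i<b. W i x) = u ^ (8 * card {i \<in> {..<b}. Y i x \<in> A})" for x
    by (simp add: W_def prod.If_cases power_mult Int_def)
  have int: "integrable M (\<lambda>x. \<Prod>i<b. W i x)"
    by (rule indep_vars_integrable[OF _ W_ind W_int]) auto
  have Seq: "S = {x \<in> space M. u ^ b \<le> (\<Prod>i<b. W i x)}" by (simp add: S_def prod)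
  show "S \<in> events" unfolding Seq using int by measurable
  have "expectation (\<lambda>x. \<Prod>i<b. W i x) = (\<Prod>i<b. expectation (W i))"
    by (rule indep_vars_lebesgue_integral[OF _ W_ind W_int]) auto
  also have "\<dots> \<le> (\<Prod>i<b. \<rho> * u)"
  proof (intro prod_mono conjI)
    fix i assume i: "i \<in> {..<b}"
    show "0 \<le> expectation (W i)" using u by (intro Bochner_Integration.integral_nonneg) (auto simp: W_def)
    show "expectation (W i) \<le> \<rho> * u" using W_exp[OF i] \<rho> i by auto
  qed
  also have "\<dots> = \<rho> ^ b * u ^ b" by (simp add: power_mult_distrib)
  finally have e: "expectation (\<lambda>x. \<Prod>i<b. W i x) \<le> \<rho> ^ b * u ^ b" .
  have "prob S \<le> expectation (\<lambda>x. \<Prod>i<b. W i x) / u ^ b"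
    unfolding Seq using int u
    by (intro integral_Markov_inequality_measure[where A="{}"]) (auto intro!: always_eventually prod_nonneg simp: W_def)
  also have "\<dots> \<le> \<rho> ^ b" using e u by (simp add: divide_le_eq)
  finally show "prob S \<le> \<rho> ^ b" .
qed

text \<open>Chebyshev's inequality with a strict inequality inside, so that it includes the case in which the root mean square is \<open>0\<close>.\<close>

lemma (in prob_space) chebyshev_root_mean_square:
  fixes Z :: "'a \<Rightarrow> real"
  assumes [measurable]: "random_variable borel Z" and int: "integrable M (\<lambda>x. (Z x)\<^sup>2)" and c: "c > 0"
  shows "prob {x \<in> space M. \<bar>Z x\<bar> > c * sqrt (expectation (\<lambda>x. (Z x)\<^sup>2))} \<le> 1 / c\<^sup>2"
proof (cases "expectation (\<lambda>x. (Z x)\<^sup>2) = 0")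
  case True
  then have "AE x in M. (Z x)\<^sup>2 = 0"
    using int by (subst integral_nonneg_eq_0_iff_AE[symmetric]) auto
  then have "prob {x \<in> space M. \<bar>Z x\<bar> > c * sqrt (expectation (\<lambda>x. (Z x)\<^sup>2))} = 0"
    unfolding True by (intro prob_eq_0[THEN iffD2]) auto
  then show ?thesis by simp
next
  case False
  let ?V = "expectation (\<lambda>x. (Z x)\<^sup>2)"
  have V: "?V > 0" using False by (simp add: less_le)
  have "prob {x \<in> space M. \<bar>Z x\<bar> > c * sqrt ?V} \<le> prob {x \<in> space M. (Z x)\<^sup>2 \<ge> c\<^sup>2 * ?V}"
  proof (rule finite_measure_mono)
    show "{x \<in> space M. \<bar>Z x\<bar> > c * sqrt ?V} \<subseteq> {x \<in> space M. (Z x)\<^sup>2 \<ge> c\<^sup>2 * ?V}"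
    proof safe
      fix x assume "c * sqrt ?V < \<bar>Z x\<bar>"
      then have "(c * sqrt ?V)\<^sup>2 \<le> \<bar>Z x\<bar>\<^sup>2" using c V by (intro power_mono) auto
      then show "c\<^sup>2 * ?V \<le> (Z x)\<^sup>2" using V by (simp add: power_mult_distrib)
    qed
  qed measurable
  also have "\<dots> \<le> ?V / (c\<^sup>2 * ?V)"
    using int c V by (intro integral_Markov_inequality_measure[where A="{}"]) auto
  finally show ?thesis using V by simp
qed

definition block_mean :: "nat \<Rightarrow> nat \<Rightarrow> (nat \<Rightarrow> real) \<Rightarrow> real" where
  "block_mean q i x = (\<Sum>j<q. x (i * q + j)) / real q"

lemma block_index_less: "i < b \<Longrightarrow> j < q \<Longrightarrow> b * q \<le> n \<Longrightarrow> i * q + j < (n :: nat)"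
  using mult_le_mono1[of "Suc i" b q] by simp

lemma measurable_block_mean:
  assumes "i < b" "b * q \<le> n"
  shows "block_mean q i \<in> borel_measurable (\<Pi>\<^sub>M i\<in>{..<n}. borel)"
  unfolding block_mean_def using block_index_less[OF assms(1) _ assms(2)]
  by (intro borel_measurable_divide borel_measurable_sum borel_measurable_const measurable_component_singleton) auto

text \<open>The blocks occupy disjoint intervals of coordinates.\<close>

lemma indep_block_means:
  assumes P: "real_distribution P" and q: "b * q \<le> n"
  shows "prob_space.indep_vars (iid_sample P n) (\<lambda>_. borel) (block_mean q) {..<b}"
proof -
  interpret prob_space "iid_sample P n" by (rule prob_space_iid_sample[OF P])
  let ?K = "\<lambda>i. {i * q..<i * q + q}"
  have "disjoint_family_on ?K {..<b}"
    unfolding disjoint_family_on_def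
  proof safe
    fix i i' x assume "i \<noteq> i'" and x: "x \<in> ?K i" "x \<in> ?K i'"
    then have "q > 0" by auto
    have "x div q = i" "x div q = i'" using x \<open>q > 0\<close>
      by (auto intro!: div_nat_eqI simp: mult.commute)
    then show "x \<in> {}" using \<open>i \<noteq> i'\<close> by simp
  qed
  moreover have "?K i \<subseteq> {..<n}" if "i \<in> {..<b}" for i
    using that q mult_le_mono1[of "Suc i" b q] by auto
  ultimately have "indep_vars (\<lambda>i. PiM (?K i) (\<lambda>_. borel)) (\<lambda>i \<omega>. restrict (\<lambda>j. \<omega> j) (?K i)) {..<b}"
    by (intro indep_vars_restrict[OF indep_iid_coordinates[OF P]])
  then have "indep_vars (\<lambda>_. borel) (\<lambda>i \<omega>. (\<lambda>f. (\<Sum>j<q. f (i * q + j)) / real q) (restrict (\<lambda>j. \<omega> j) (?K i))) {..<b}"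
    by (rule indep_vars_compose2)
       (intro borel_measurable_divide borel_measurable_sum borel_measurable_const measurable_component_singleton, auto)
  also have "(\<lambda>i \<omega>. (\<lambda>f. (\<Sum>j<q. f (i * q + j)) / real q) (restrict (\<lambda>j. \<omega> j) (?K i))) = block_mean q"
    by (intro ext) (simp add: block_mean_def)
  finally show ?thesis .
qed

text \<open>A block of \<open>q\<close> coordinates is itself an i.i.d. sample of size \<open>q\<close>, by reindexing the product measure.\<close>

lemma prob_block_mean:
  assumes P: "real_distribution P" and i: "i < b" "b * q \<le> n" and A [measurable]: "A \<in> sets borel"
  shows "\<P>(x in iid_sample P n. block_mean q i x \<in> A) = \<P>(x in iid_sample P q. (\<Sum>j<q. x j) / real q \<in> A)"
proof -
  let ?t = "\<lambda>\<omega>. \<lambda>j\<in>{..<q}. \<omega> (i * q + j)"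
  have eq: "distr (iid_sample P n) (iid_sample P q) ?t = iid_sample P q"
    unfolding iid_sample_def using block_index_less[OF i(1) _ i(2)] P
    by (intro distr_PiM_reindex[where M="\<lambda>_. P" and K="{..<n}"])
       (auto simp: real_distribution_def inj_on_def)
  have t: "?t \<in> measurable (iid_sample P n) (iid_sample P q)"
    unfolding iid_sample_def using block_index_less[OF i(1) _ i(2)]
    by (intro measurable_restrict measurable_component_singleton) auto
  note [measurable] = measurable_iid_sum[OF P]
  have "\<P>(x in iid_sample P q. (\<Sum>j<q. x j) / real q \<in> A) =
     measure (distr (iid_sample P n) (iid_sample P q) ?t) {x \<in> space (iid_sample P q). (\<Sum>j<q. x j) / real q \<in> A}"
    unfolding eq ..
  also have "\<dots> = measure (iid_sample P n) (?t -` {x \<in> space (iid_sample P q). (\<Sum>j<q. x j) / real q \<in> A} \<inter> space (iid_sample P n))"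
    using t by (intro measure_distr) auto
  also have "?t -` {x \<in> space (iid_sample P q). (\<Sum>j<q. x j) / real q \<in> A} \<inter> space (iid_sample P n) =
     {x \<in> space (iid_sample P n). block_mean q i x \<in> A}"
    using measurable_space[OF t] by (auto simp: block_mean_def)
  finally show ?thesis ..
qed

lemma prob_block_mean_far:
  assumes P: "P \<in> P2" and i: "i < b" "b * q \<le> n" and q: "q > 0" and c: "c > 0"
  shows "\<P>(x in iid_sample P n. block_mean q i x \<in> {y. \<bar>y - dist_mean P\<bar> > c * (dist_sd P / sqrt (real q))}) \<le> 1 / c\<^sup>2"
proof -
  note D = P2_properties[OF P]
  interpret I: prob_space "iid_sample P q" by (rule prob_space_iid_sample[OF D(1)])
  note [measurable] = measurable_iid_sum[OF D(1)]
  let ?X = "\<lambda>j x. (x j - dist_mean P) / real q"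
  have sq: "(\<lambda>x. ((x - dist_mean P) / real q)\<^sup>2) \<in> borel_measurable borel" by measurable
  have m1: "(\<lambda>x. (x - dist_mean P) / real q) \<in> borel_measurable borel" by measurable
  have 1: "integrable (iid_sample P q) (\<lambda>x. (\<Sum>j<q. ?X j x)\<^sup>2) \<and>
    I.expectation (\<lambda>x. (\<Sum>j<q. ?X j x)\<^sup>2) = (\<Sum>j<q. I.expectation (\<lambda>x. (?X j x)\<^sup>2))"
  proof (rule I.indep_vars_second_moment_sum)
    show "I.indep_vars (\<lambda>_. borel) ?X {..<q}"
      by (rule I.indep_vars_compose2[OF indep_iid_coordinates[OF D(1)]]) measurable
    show "integrable (iid_sample P q) (\<lambda>x. (?X j x)\<^sup>2)" if "j \<in> {..<q}" for j
      using that D(4) iid_coordinate_transfer(1)[OF D(1) _ sq, of j q] by (simp add: power_divide)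
    show "I.expectation (?X j) = 0" if "j \<in> {..<q}" for j
      using that D(5) iid_coordinate_transfer(2)[OF D(1) _ m1, of j q] by simp
  qed auto
  have S: "(\<Sum>j<q. ?X j x) = (\<Sum>j<q. x j) / real q - dist_mean P" for x
    using q by (simp add: sum_divide_distrib[symmetric] sum_subtractf diff_divide_distrib)
  have "I.expectation (\<lambda>x. (?X j x)\<^sup>2) = (dist_sd P)\<^sup>2 / (real q)\<^sup>2" if "j < q" for j
    using that D(6) iid_coordinate_transfer(2)[OF D(1) _ sq, of j q] by (simp add: power_divide)
  then have "I.expectation (\<lambda>x. ((\<Sum>j<q. x j) / real q - dist_mean P)\<^sup>2) = (dist_sd P)\<^sup>2 / real q"
    using 1 q by (simp add: S power2_eq_square)
  then have sd: "sqrt (I.expectation (\<lambda>x. ((\<Sum>j<q. x j) / real q - dist_mean P)\<^sup>2)) = dist_sd P / sqrt (real q)"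
    using D(7) by (simp add: real_sqrt_divide)
  have "I.prob {x \<in> space (iid_sample P q). \<bar>(\<Sum>j<q. x j) / real q - dist_mean P\<bar> >
      c * sqrt (I.expectation (\<lambda>x. ((\<Sum>j<q. x j) / real q - dist_mean P)\<^sup>2))} \<le> 1 / c\<^sup>2"
    using 1 c unfolding S by (intro I.chebyshev_root_mean_square) auto
  then show ?thesis
    unfolding sd by (subst prob_block_mean[OF D(1) i]) auto
qed

section \<open>Quantile intervals and the selection of a point\<close>

text \<open>Measurability is immediate if order statistics are written as minima of maxima over index sets: the lower end below is
  the smallest \<open>v\<close> such that more than an eighth of the values are at most \<open>v\<close>.\<close>

definition eighth_subsets :: "nat \<Rightarrow> nat set set" where
  "eighth_subsets b = {S. S \<subseteq> {..<b} \<and> b < 8 * card S}"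

definition lower_end :: "nat \<Rightarrow> (nat \<Rightarrow> real) \<Rightarrow> real" where
  "lower_end b Y = Min ((\<lambda>S. Max (Y ` S)) ` eighth_subsets b)"

definition upper_end :: "nat \<Rightarrow> (nat \<Rightarrow> real) \<Rightarrow> real" where
  "upper_end b Y = Max ((\<lambda>S. Min (Y ` S)) ` eighth_subsets b)"

lemma finite_majority_sets: "finite (eighth_subsets b)"
  by (rule finite_subset[of _ "Pow {..<b}"]) (auto simp: eighth_subsets_def)

lemma eighth_subsetsD: "S \<in> eighth_subsets b \<Longrightarrow> finite S \<and> S \<noteq> {} \<and> S \<subseteq> {..<b}"
  by (auto simp: eighth_subsets_def intro: finite_subset)

lemma eighth_subsets_nonempty: "b > 0 \<Longrightarrow> eighth_subsets b \<noteq> {}"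
  by (auto simp: eighth_subsets_def intro!: exI[of _ "{..<b}"])

lemma measurable_lower_end [measurable (raw)]:
  assumes "\<And>i. i < b \<Longrightarrow> Y i \<in> borel_measurable M"
  shows "(\<lambda>x. lower_end b (\<lambda>i. Y i x)) \<in> borel_measurable M"
  unfolding lower_end_def using assms eighth_subsetsD
  by (intro borel_measurable_Min borel_measurable_Max finite_majority_sets) blast+

lemma measurable_upper_end [measurable (raw)]:
  assumes "\<And>i. i < b \<Longrightarrow> Y i \<in> borel_measurable M"
  shows "(\<lambda>x. upper_end b (\<lambda>i. Y i x)) \<in> borel_measurable M"
  unfolding upper_end_def using assms eighth_subsetsD
  by (intro borel_measurable_Min borel_measurable_Max finite_majority_sets) blast+

lemma lower_end_le:
  assumes "b < 8 * card {i \<in> {..<b}. Y i \<le> v}"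
  shows "lower_end b Y \<le> v"
proof -
  let ?S = "{i \<in> {..<b}. Y i \<le> v}"
  have S: "?S \<in> eighth_subsets b" using assms by (auto simp: eighth_subsets_def)
  then have "lower_end b Y \<le> Max (Y ` ?S)"
    unfolding lower_end_def by (intro Min_le finite_imageI finite_majority_sets) auto
  also have "\<dots> \<le> v" using eighth_subsetsD[OF S] by (subst Max_le_iff) auto
  finally show ?thesis .
qed

lemma upper_end_ge:
  assumes "b < 8 * card {i \<in> {..<b}. v \<le> Y i}"
  shows "v \<le> upper_end b Y"
proof -
  let ?S = "{i \<in> {..<b}. v \<le> Y i}"
  have S: "?S \<in> eighth_subsets b" using assms by (auto simp: eighth_subsets_def)
  have "v \<le> Min (Y ` ?S)" using eighth_subsetsD[OF S] by (subst Min_ge_iff) auto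
  also have "\<dots> \<le> upper_end b Y"
    unfolding upper_end_def using S by (intro Max_ge finite_imageI finite_majority_sets) auto
  finally show ?thesis .
qed

lemma eighth_subset_not_covered:
  assumes "S \<in> eighth_subsets b" and "8 * card B \<le> b" and "finite B"
  obtains i where "i \<in> S" "i \<notin> B"
proof -
  have "card B < card S" using assms by (auto simp: eighth_subsets_def)
  then have "\<not> S \<subseteq> B" using card_mono[OF assms(3)] by (meson not_le)
  then show ?thesis using that by auto
qed

text \<open>Every index set with more than an eighth of the indices contains one whose value is close to \<open>v\<close>.\<close>

lemma lower_end_upper_end_near:
  assumes b: "b > 0" and far: "8 * card {i \<in> {..<b}. \<bar>Y i - v\<bar> > r} \<le> b"
  shows "v - r \<le> lower_end b Y" "upper_end b Y \<le> v + r"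
proof -
  have *: "\<exists>i\<in>S. \<bar>Y i - v\<bar> \<le> r" if S: "S \<in> eighth_subsets b" for S
  proof -
    obtain i where i: "i \<in> S" "i \<notin> {i \<in> {..<b}. \<bar>Y i - v\<bar> > r}"
      using eighth_subset_not_covered[OF S far] by auto
    moreover have "i < b" using eighth_subsetsD[OF S] i(1) by auto
    ultimately show ?thesis by (intro bexI[of _ i]) (simp_all add: not_less)
  qed
  show "v - r \<le> lower_end b Y"
    unfolding lower_end_def
  proof (subst Min_ge_iff; safe?)
    fix S assume S: "S \<in> eighth_subsets b"
    obtain i where "i \<in> S" "\<bar>Y i - v\<bar> \<le> r" using *[OF S] by auto
    then show "v - r \<le> Max (Y ` S)"
      using eighth_subsetsD[OF S] by (intro order_trans[OF _ Max_ge[of "Y ` S" "Y i"]]) auto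
  qed (use b finite_majority_sets eighth_subsets_nonempty in auto)
  show "upper_end b Y \<le> v + r"
    unfolding upper_end_def
  proof (subst Max_le_iff; safe?)
    fix S assume S: "S \<in> eighth_subsets b"
    obtain i where "i \<in> S" "\<bar>Y i - v\<bar> \<le> r" using *[OF S] by auto
    then show "Min (Y ` S) \<le> v + r"
      using eighth_subsetsD[OF S] by (intro order_trans[OF Min_le[of "Y ` S" "Y i"]]) auto
  qed (use b finite_majority_sets eighth_subsets_nonempty in auto)
qed

text \<open>The choice works simultaneously for all starting indices \<open>m\<close>: let \<open>E\<close> be the largest lower end over the longest final
  segment of intervals that has a common point.  If the intervals from \<open>m\<close> on share a point, this segment starts at or before \<open>m\<close>, so
  \<open>E\<close> lies in the \<open>m\<close>-th interval.\<close>

lemma measurable_selection_from_intervals: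
  fixes lo hi :: "nat \<Rightarrow> 'a \<Rightarrow> real"
  assumes lo [measurable]: "\<And>b. b \<le> B \<Longrightarrow> lo b \<in> borel_measurable M"
    and hi [measurable]: "\<And>b. b \<le> B \<Longrightarrow> hi b \<in> borel_measurable M"
  shows "\<exists>E\<in>borel_measurable M. \<forall>x v m. m \<le> B \<longrightarrow> (\<forall>b\<in>{m..B}. lo b x \<le> v \<and> v \<le> hi b x) \<longrightarrow>
     lo m x \<le> E x \<and> E x \<le> hi m x"
proof -
  \<comment> \<open>The intervals with indices in \<open>{m..B}\<close> intersect in the interval from \<open>A m x\<close> to \<open>D m x\<close>.\<close>
  define A where "A m x = Max ((\<lambda>b. lo b x) ` {m..B})" for m x
  define D where "D m x = Min ((\<lambda>b. hi b x) ` {m..B})" for m x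
  have [measurable]: "A m \<in> borel_measurable M" "D m \<in> borel_measurable M" for m
    unfolding A_def D_def
    by (rule borel_measurable_Max borel_measurable_Min; simp add: lo hi)+
  define mhat where "mhat x = (LEAST m. A m x \<le> D m x)" for x
  have [measurable]: "mhat \<in> measurable M (count_space UNIV)"
    unfolding mhat_def by measurable
  define E where "E x = A (mhat x) x" for x
  have "E \<in> borel_measurable M"
    unfolding E_def by (rule measurable_compose_countable[where f=A]) auto
  moreover have "lo m x \<le> E x \<and> E x \<le> hi m x"
    if m: "m \<le> B" and v: "\<forall>b\<in>{m..B}. lo b x \<le> v \<and> v \<le> hi b x" for x v m
  proof -
    have "A m x \<le> v" unfolding A_def using m v by (subst Max_le_iff) auto
    also have "v \<le> D m x" unfolding D_def using m v by (subst Min_ge_iff) auto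
    finally have 0: "A m x \<le> D m x" .
    have le: "mhat x \<le> m" unfolding mhat_def using 0 by (rule Least_le)
    have "A (mhat x) x \<le> D (mhat x) x" unfolding mhat_def using 0 by (rule LeastI)
    moreover have "lo m x \<le> A (mhat x) x" unfolding A_def using le m by (intro Max_ge) auto
    moreover have "D (mhat x) x \<le> hi m x" unfolding D_def using le m by (intro Min_le) auto
    ultimately show ?thesis by (simp add: E_def)
  qed
  ultimately show ?thesis by blast
qed

text \<open>From \<open>ln 2 \<ge> 1/2\<close>, \<open>ln 3 \<ge> 1\<close> and \<open>e \<ge> 5/2\<close> one gets \<open>16 \<cdot> 252 \<cdot> (5/2)\<^sup>5 = 393750\<close>.\<close>

lemma L_star_bound: "390000 \<le> L_star\<^sup>2" "L_star > 0"
proof -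
  have l2: "ln 2 \<ge> (1/2 :: real)" using ln2_ge_two_thirds by simp
  have l3: "ln 3 \<ge> (1 :: real)" using exp_le by (simp add: ln_ge_iff)
  have "2 * (1 + 2 * ln 2) * (1 + 62 * ln 3) \<ge> 2 * (1 + 2 * (1/2)) * (1 + 62 * (1 :: real))"
    using l2 l3 by (intro mult_mono) auto
  then have a: "2 * (1 + 2 * ln 2) * (1 + 62 * ln 3) \<ge> (252 :: real)" by simp
  have "(5/2 :: real) \<le> exp 1" using exp_lower_Taylor_quadratic[of "1::real"] by simp
  then have "(5/2 :: real) ^ 5 \<le> exp 1 ^ 5" by (intro power_mono) auto
  also have "\<dots> = (exp (5/2))\<^sup>2" by (simp add: exp_of_nat_mult[symmetric] power2_eq_square exp_add[symmetric])
  finally have e: "(exp (5/2 :: real))\<^sup>2 \<ge> 3125/32" by (simp add: power_divide)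
  have "L_star\<^sup>2 = 16 * (2 * (1 + 2 * ln 2) * (1 + 62 * ln 3)) * (exp (5/2))\<^sup>2"
    unfolding L_star_def using a by (simp add: power_mult_distrib del: exp_half_le2)
  also have "\<dots> \<ge> 16 * 252 * (3125/32)"
    using a e by (intro mult_mono) auto
  finally show "390000 \<le> L_star\<^sup>2" by simp
  show "L_star > 0" unfolding L_star_def using l2 l3 by (intro mult_pos_pos real_sqrt_gt_zero) auto
qed

section \<open>The estimator for regular distributions\<close>

definition block_lower :: "nat \<Rightarrow> nat \<Rightarrow> (nat \<Rightarrow> real) \<Rightarrow> real" where
  "block_lower n b x = lower_end b (\<lambda>i. block_mean (n div b) i x)"

definition block_upper :: "nat \<Rightarrow> nat \<Rightarrow> (nat \<Rightarrow> real) \<Rightarrow> real" where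
  "block_upper n b x = upper_end b (\<lambda>i. block_mean (n div b) i x)"

lemma measurable_block_ends:
  "block_lower n b \<in> borel_measurable (\<Pi>\<^sub>M i\<in>{..<n}. borel)"
  "block_upper n b \<in> borel_measurable (\<Pi>\<^sub>M i\<in>{..<n}. borel)"
  unfolding block_lower_def block_upper_def
  by (auto intro!: measurable_lower_end measurable_upper_end measurable_block_mean[of _ b])

lemma prob_block_mean_side:
  assumes P: "P \<in> P2_reg k" and b: "i < b" "b \<le> n div k" and k: "k \<ge> 1"
  shows "\<P>(x in iid_sample P n. block_mean (n div b) i x \<in> {..dist_mean P}) \<ge> 1/3"
    "\<P>(x in iid_sample P n. block_mean (n div b) i x \<in> {dist_mean P..}) \<ge> 1/3"
proof -
  have P2: "P \<in> P2" using P by (simp add: P2_reg_def)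
  have "b * k \<le> n" using b(2) by (metis div_times_less_eq_dividend le_trans mult_le_mono1)
  then have q: "n div b \<ge> k" using b(1) by (simp add: less_eq_div_iff_mult_less_eq mult.commute)
  with k have q0: "n div b > 0" by linarith
  have reg: "p_minus P (n div b) \<ge> 1/3" "p_plus P (n div b) \<ge> 1/3"
    using P q by (auto simp: P2_reg_def)
  have bq: "b * (n div b) \<le> n" by simp
  show "\<P>(x in iid_sample P n. block_mean (n div b) i x \<in> {..dist_mean P}) \<ge> 1/3"
    using reg(1) q0 unfolding p_minus_def
    by (subst prob_block_mean[OF P2_properties(1)[OF P2] b(1) bq]) (auto simp: divide_le_eq mult.commute)
  show "\<P>(x in iid_sample P n. block_mean (n div b) i x \<in> {dist_mean P..}) \<ge> 1/3"
    using reg(2) q0 unfolding p_plus_def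
    by (subst prob_block_mean[OF P2_properties(1)[OF P2] b(1) bq]) (auto simp: le_divide_eq mult.commute)
qed

text \<open>Failure means that at most an eighth of the block means lie on one side of the mean, whereas each does so with
  probability at least \<open>1/3\<close>.\<close>

lemma block_interval_covers:
  assumes P: "P \<in> P2_reg k" and b: "b \<le> n div k" and k: "k \<ge> 1"
  shows "\<exists>S\<in>sets (iid_sample P n). measure (iid_sample P n) S \<le> 2 * (9/10) ^ b \<and>
    (\<forall>x\<in>space (iid_sample P n) - S. block_lower n b x \<le> dist_mean P \<and> dist_mean P \<le> block_upper n b x)"
proof -
  have R: "real_distribution P" using P by (auto simp: P2_reg_def P2_def)
  interpret prob_space "iid_sample P n" by (rule prob_space_iid_sample[OF R])
  define Bad where "Bad A = {x \<in> space (iid_sample P n).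
    (5/6 :: real) ^ b \<le> (5/6) ^ (8 * card {i \<in> {..<b}. block_mean (n div b) i x \<in> A})}" for A
  have ind: "indep_vars (\<lambda>_. borel) (block_mean (n div b)) {..<b}"
    by (rule indep_block_means[OF R]) simp
  \<comment> \<open>\<open>(5/6)\<^sup>8 \<le> 1/4\<close>, and \<open>1 - 3/4 \<cdot> 1/3 = 3/4 = 9/10 \<cdot> 5/6\<close>.\<close>
  have num: "1 + ((5/6) ^ 8 - 1) * p \<le> 9/10 * (5/6 :: real)" if "p \<ge> 1/3" for p :: real
  proof -
    have "(5/6 :: real) ^ 8 - 1 \<le> - 3/4" by (simp add: power_divide)
    then have "((5/6 :: real) ^ 8 - 1) * p \<le> (- 3/4) * p" using that by (intro mult_right_mono) auto
    then show ?thesis using that by linarith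
  qed
  have bad: "Bad A \<in> events \<and> prob (Bad A) \<le> (9/10) ^ b"
    if A: "A \<in> {{..dist_mean P}, {dist_mean P..}}" for A
  proof -
    have "A \<in> sets borel" using A by auto
    moreover have "1 + ((5/6) ^ 8 - 1) * prob {x \<in> space (iid_sample P n). block_mean (n div b) i x \<in> A} \<le> 9/10 * (5/6)"
      if i: "i < b" for i
      using A prob_block_mean_side[OF P i b k] by (intro num) blast
    ultimately show ?thesis
      unfolding Bad_def by (intro conjI indep_count_tail[OF ind, of A "5/6" "9/10"]) simp_all
  qed
  have notBad: "b < 8 * card {i \<in> {..<b}. block_mean (n div b) i x \<in> A}"
    if "x \<in> space (iid_sample P n)" "x \<notin> Bad A" for x A
  proof (rule ccontr)
    assume "\<not> ?thesis"
    then have "(5/6 :: real) ^ b \<le> (5/6) ^ (8 * card {i \<in> {..<b}. block_mean (n div b) i x \<in> A})"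
      by (intro power_decreasing) auto
    with that show False by (simp add: Bad_def)
  qed
  show ?thesis
  proof (intro bexI conjI ballI)
    show "Bad {..dist_mean P} \<union> Bad {dist_mean P..} \<in> events" using bad by blast
    have "prob (Bad {..dist_mean P} \<union> Bad {dist_mean P..}) \<le> prob (Bad {..dist_mean P}) + prob (Bad {dist_mean P..})"
      using bad by (intro measure_Un_le) blast+
    also have "\<dots> \<le> 2 * (9/10) ^ b"
      using bad[of "{..dist_mean P}"] bad[of "{dist_mean P..}"] by simp
    finally show "prob (Bad {..dist_mean P} \<union> Bad {dist_mean P..}) \<le> 2 * (9/10) ^ b" .
    fix x assume x: "x \<in> space (iid_sample P n) - (Bad {..dist_mean P} \<union> Bad {dist_mean P..})"
    show "block_lower n b x \<le> dist_mean P" unfolding block_lower_def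
      using x notBad[of x "{..dist_mean P}"] by (intro lower_end_le) auto
    show "dist_mean P \<le> block_upper n b x" unfolding block_upper_def
      using x notBad[of x "{dist_mean P..}"] by (intro upper_end_ge) auto
  qed
qed

text \<open>Chebyshev's inequality makes a far block mean an event of probability at most \<open>1/1024\<close>, and a long interval requires that more than an eighth of the block
  means are far.\<close>

lemma block_interval_short:
  assumes P: "P \<in> P2" and b: "b \<le> n" "b > 0"
  defines "r \<equiv> 32 * (dist_sd P / sqrt (real (n div b)))"
  shows "\<exists>S\<in>sets (iid_sample P n). measure (iid_sample P n) S \<le> (9/10) ^ b \<and>
    (\<forall>x\<in>space (iid_sample P n) - S. dist_mean P - r \<le> block_lower n b x \<and> block_upper n b x \<le> dist_mean P + r)"
proof -
  have R: "real_distribution P" using P by (auto simp: P2_def)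
  interpret prob_space "iid_sample P n" by (rule prob_space_iid_sample[OF R])
  let ?A = "{y. \<bar>y - dist_mean P\<bar> > r}"
  define S where "S = {x \<in> space (iid_sample P n).
    (2 :: real) ^ b \<le> 2 ^ (8 * card {i \<in> {..<b}. block_mean (n div b) i x \<in> ?A})}"
  have ind: "indep_vars (\<lambda>_. borel) (block_mean (n div b)) {..<b}"
    by (rule indep_block_means[OF R]) simp
  have q: "n div b > 0" using b by (simp add: div_greater_zero_iff)
  have "1 + (2 ^ 8 - 1) * prob {x \<in> space (iid_sample P n). block_mean (n div b) i x \<in> ?A} \<le> 9/10 * 2" if "i < b" for i
  proof -
    have "prob {x \<in> space (iid_sample P n). block_mean (n div b) i x \<in> ?A} \<le> 1 / 32\<^sup>2"
      unfolding r_def by (rule prob_block_mean_far[OF P that _ q]) auto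
    then show ?thesis by simp
  qed
  then have S: "S \<in> events" "prob S \<le> (9/10) ^ b"
    unfolding S_def by (intro indep_count_tail[OF ind, of ?A 2 "9/10"]; simp)+
  show ?thesis
  proof (intro bexI[OF _ S(1)] conjI ballI S(2))
    fix x assume x: "x \<in> space (iid_sample P n) - S"
    have "8 * card {i \<in> {..<b}. \<bar>block_mean (n div b) i x - dist_mean P\<bar> > r} \<le> b"
    proof (rule ccontr)
      assume "\<not> ?thesis"
      then have "(2 :: real) ^ b \<le> 2 ^ (8 * card {i \<in> {..<b}. block_mean (n div b) i x \<in> ?A})"
        by (intro power_increasing) auto
      with x show False by (simp add: S_def)
    qed
    from lower_end_upper_end_near[OF b(2) this]
    show "dist_mean P - r \<le> block_lower n b x" "block_upper n b x \<le> dist_mean P + r"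
      unfolding block_lower_def block_upper_def by this+
  qed
qed

lemma geometric_tail_sum: "(\<Sum>b\<in>{m..B}. 2 * (9/10 :: real) ^ b) \<le> 20 * (9/10) ^ m"
  by (simp add: sum_distrib_left[symmetric] sum_gp)

text \<open>The bad event is the union over \<open>b \<ge> m\<close> of the failures of coverage, which sum to \<open>20 (9/10)\<^sup>m\<close>, together with the event that the \<open>m\<close>-th interval is long.\<close>

lemma exists_measurable_block_estimator:
  fixes n k :: nat
  assumes k: "k \<ge> 1"
  shows "\<exists>E\<in>borel_measurable (\<Pi>\<^sub>M i\<in>{..<n}. (borel :: real measure)). \<forall>P\<in>P2_reg k. \<forall>m. 1 \<le> m \<longrightarrow> m \<le> n div k \<longrightarrow>
    \<P>(x in iid_sample P n. \<bar>E x - dist_mean P\<bar> > 32 * (dist_sd P / sqrt (real (n div m)))) \<le> 21 * (9/10) ^ m"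
proof -
  obtain E where E: "E \<in> borel_measurable (\<Pi>\<^sub>M i\<in>{..<n}. (borel :: real measure))"
    and sel: "\<And>x v m. m \<le> n div k \<Longrightarrow> (\<And>b. b \<in> {m..n div k} \<Longrightarrow> block_lower n b x \<le> v \<and> v \<le> block_upper n b x) \<Longrightarrow>
     block_lower n m x \<le> E x \<and> E x \<le> block_upper n m x"
    using measurable_selection_from_intervals[of "n div k" "block_lower n" "\<Pi>\<^sub>M i\<in>{..<n}. borel" "block_upper n"]
      measurable_block_ends by blast
  show ?thesis
  proof (intro bexI[OF _ E] ballI allI impI)
    fix P m assume P: "P \<in> P2_reg k" and m: "1 \<le> m" "m \<le> n div k"
    have P2: "P \<in> P2" using P by (simp add: P2_reg_def)
    have R: "real_distribution P" using P2 by (auto simp: P2_def)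
    interpret prob_space "iid_sample P n" by (rule prob_space_iid_sample[OF R])
    let ?r = "32 * (dist_sd P / sqrt (real (n div m)))"
    have "\<forall>b\<in>{m..n div k}. \<exists>S\<in>events. prob S \<le> 2 * (9/10) ^ b \<and>
      (\<forall>x\<in>space (iid_sample P n) - S. block_lower n b x \<le> dist_mean P \<and> dist_mean P \<le> block_upper n b x)"
      using block_interval_covers[OF P _ k] by simp
    then obtain S where S: "\<And>b. b \<in> {m..n div k} \<Longrightarrow> S b \<in> events"
      "\<And>b. b \<in> {m..n div k} \<Longrightarrow> prob (S b) \<le> 2 * (9/10) ^ b"
      "\<And>b x. b \<in> {m..n div k} \<Longrightarrow> x \<in> space (iid_sample P n) - S b \<Longrightarrow>
         block_lower n b x \<le> dist_mean P \<and> dist_mean P \<le> block_upper n b x"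
      by metis
    have "m \<le> n" using m(2) by (meson div_le_dividend le_trans)
    then obtain T where T: "T \<in> events" "prob T \<le> (9/10) ^ m" "\<And>x. x \<in> space (iid_sample P n) - T \<Longrightarrow>
        dist_mean P - ?r \<le> block_lower n m x \<and> block_upper n m x \<le> dist_mean P + ?r"
      using block_interval_short[OF P2 _, of m n] m(1) by auto
    have "prob {x \<in> space (iid_sample P n). \<bar>E x - dist_mean P\<bar> > ?r} \<le> prob ((\<Union>b\<in>{m..n div k}. S b) \<union> T)"
    proof (rule finite_measure_mono)
      show "{x \<in> space (iid_sample P n). \<bar>E x - dist_mean P\<bar> > ?r} \<subseteq> (\<Union>b\<in>{m..n div k}. S b) \<union> T"
      proof (rule subsetI, rule ccontr)
        fix x assume x: "x \<in> {x \<in> space (iid_sample P n). \<bar>E x - dist_mean P\<bar> > ?r}"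
          and nx: "x \<notin> (\<Union>b\<in>{m..n div k}. S b) \<union> T"
        have "block_lower n b x \<le> dist_mean P \<and> dist_mean P \<le> block_upper n b x" if "b \<in> {m..n div k}" for b
          using S(3)[OF that, of x] x nx that by auto
        from sel[OF m(2) this] have "block_lower n m x \<le> E x" "E x \<le> block_upper n m x" by auto
        with T(3)[of x] x nx have "dist_mean P - ?r \<le> E x \<and> E x \<le> dist_mean P + ?r" by force
        with x show False by auto
      qed
      show "(\<Union>b\<in>{m..n div k}. S b) \<union> T \<in> events" using S(1) T(1) by auto
    qed
    also have "\<dots> \<le> prob (\<Union>b\<in>{m..n div k}. S b) + prob T"
      using S(1) T(1) by (intro measure_Un_le) auto
    also have "prob (\<Union>b\<in>{m..n div k}. S b) \<le> (\<Sum>b\<in>{m..n div k}. prob (S b))"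
      using S(1) by (intro finite_measure_subadditive_finite) auto
    also have "\<dots> \<le> (\<Sum>b\<in>{m..n div k}. 2 * (9/10) ^ b)"
      by (intro sum_mono S(2))
    also have "\<dots> \<le> 20 * (9/10) ^ m" by (rule geometric_tail_sum)
    finally show "prob {x \<in> space (iid_sample P n). \<bar>E x - dist_mean P\<bar> > ?r} \<le> 21 * (9/10) ^ m"
      using T(2) by simp
  qed
qed

text \<open>The least \<open>m\<close> with \<open>m \<ge> 10 ln (21/\<delta>)\<close> works, because \<open>9/10 \<le> e\<^bsup>-1/10\<^esup>\<close>.  It is at most \<open>n div k\<close> because \<open>\<delta> \<ge> 4 e\<^bsup>3 - n/(124k)\<^esup>\<close> and
  \<open>21 \<le> 4 e\<^sup>3\<close>.\<close>

lemma block_number_for_confidence: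
  assumes k: "k \<ge> 1" and n: "real n \<ge> (3 + ln 4) * 124 * real k" and \<delta>: "\<delta> \<in> {delta_min n k..<1}"
  obtains m where "1 \<le> m" "m \<le> n div k" "21 * (9/10) ^ m \<le> \<delta>" "real m \<le> 51 * (1 + ln (1 / \<delta>))"
proof -
  have \<delta>0: "\<delta> > 0" using \<delta> unfolding delta_min_def by (intro less_le_trans[OF _ \<delta>[THEN atLeastLessThan_iff[THEN iffD1], THEN conjunct1]]) (simp add: delta_min_def)
  define l where "l = ln (1 / \<delta>)"
  have l0: "l > 0" using \<delta> \<delta>0 by (simp add: l_def)
  have l_le: "l \<le> real n / (124 * real k) - 3 - ln 4"
  proof -
    have "ln (delta_min n k) \<le> ln \<delta>" using \<delta> \<delta>0 by (subst ln_le_cancel_iff) (auto simp: delta_min_def)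
    moreover have "ln (delta_min n k) = ln 4 + (3 - real n / (124 * real k))"
      unfolding delta_min_def by (subst ln_mult) auto
    ultimately show ?thesis using \<delta>0 by (simp add: l_def ln_div)
  qed
  have l4: "ln 4 \<le> (2 :: real)" "ln 4 \<ge> (0 :: real)"
    using ln_le_minus_one[of "2 :: real"] ln_realpow[of 2 2] by simp_all
  \<comment> \<open>The additive constant of the lowest admissible \<open>\<delta>\<close> absorbs the factor \<open>21\<close> of the failure probability.\<close>
  have l21: "ln 21 \<le> 3 + ln (4 :: real)"
  proof -
    have "(21 :: real) \<le> 4 * exp 3"
    proof -
      have "(2 :: real) ^ 3 \<le> exp 1 ^ 3" using exp_ge_add_one_self[of "1::real"] by (intro power_mono) auto
      also have "exp (1 :: real) ^ 3 = exp 3" by (simp add: exp_of_nat_mult[symmetric])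
      finally show ?thesis by simp
    qed
    then have "ln 21 \<le> ln (4 * exp (3 :: real))" by (subst ln_le_cancel_iff) auto
    also have "\<dots> = 3 + ln 4" by (subst ln_mult) auto
    finally show ?thesis .
  qed
  define m where "m = nat \<lceil>10 * (ln 21 + l)\<rceil>"
  have m_ge: "real m \<ge> 10 * (ln 21 + l)" unfolding m_def by linarith
  have m_le: "real m \<le> 10 * (ln 21 + l) + 1"
  proof -
    have "10 * (ln 21 + l) \<ge> 0" using l0 by (intro mult_nonneg_nonneg add_nonneg_nonneg) auto
    then show ?thesis unfolding m_def by linarith
  qed
  show ?thesis
  proof
    have "real m > 0"
      by (rule less_le_trans[OF _ m_ge]) (use l0 in \<open>auto intro!: add_nonneg_pos\<close>)
    then show "1 \<le> m" by simp
    define y where "y = real n / (124 * real k)"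
    have y: "y \<ge> 3 + ln 4" using n k by (simp add: y_def field_simps)
    have "real m \<le> 10 * y + 1" using m_le l_le l21 by (simp add: y_def)
    also have "\<dots> \<le> 124 * y" using y l4 by linarith
    also have "\<dots> = real n / real k" by (simp add: y_def)
    finally have "real m * real k \<le> real n" using k by (simp add: field_simps)
    then have "m * k \<le> n" by (metis of_nat_le_iff of_nat_mult)
    then show "m \<le> n div k" using k by (simp add: less_eq_div_iff_mult_less_eq)
    have "(9/10 :: real) \<le> exp (- 1/10)" using exp_ge_add_one_self[of "- 1/10 :: real"] by simp
    then have "(9/10 :: real) ^ m \<le> exp (- 1/10) ^ m" by (intro power_mono) auto
    also have "\<dots> = exp (- real m / 10)" by (simp add: exp_of_nat_mult[symmetric])
    also have "\<dots> \<le> exp (- (ln 21 + l))" using m_ge by simp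
    also have "\<dots> = \<delta> / 21" using \<delta>0 by (simp add: l_def exp_minus exp_add ln_div exp_diff field_simps)
    finally show "21 * (9/10) ^ m \<le> \<delta>" by simp
    have "real m \<le> 10 * ln 21 + 10 * l + 1" using m_le by (simp add: distrib_left)
    then have "real m \<le> 10 * l + 51" using l21 l4 by linarith
    then show "real m \<le> 51 * (1 + ln (1 / \<delta>))" using l0 unfolding l_def[symmetric] by (simp add: distrib_left)
  qed
qed

text \<open>Since \<open>n \<le> 2 m (n div m)\<close>, the squared radius \<open>1024 \<sigma>\<^sup>2 / (n div m)\<close> is at most \<open>2048 \<cdot> 51 \<sigma>\<^sup>2 (1 + ln (1/\<delta>)) / n\<close>, and
  \<open>2048 \<cdot> 51 = 104448\<close> is below \<open>L_star\<^sup>2\<close>.\<close>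

theorem exists_multiple_delta_estimator_for_regular:
  assumes k: "k \<ge> 1" and n: "real n \<ge> (3 + ln 4) * 124 * real k"
  shows "\<exists>E. multiple_delta_subgaussian L_star (P2_reg k) n (delta_min n k) E"
proof -
  obtain E where E: "E \<in> borel_measurable (\<Pi>\<^sub>M i\<in>{..<n}. (borel :: real measure))"
    and tail: "\<And>P m. P \<in> P2_reg k \<Longrightarrow> 1 \<le> m \<Longrightarrow> m \<le> n div k \<Longrightarrow>
    \<P>(x in iid_sample P n. \<bar>E x - dist_mean P\<bar> > 32 * (dist_sd P / sqrt (real (n div m)))) \<le> 21 * (9/10) ^ m"
    using exists_measurable_block_estimator[OF k, of n] by blast
  have "\<P>(x in iid_sample P n. \<bar>E x - dist_mean P\<bar> > subgaussian_radius L_star P n \<delta>) \<le> \<delta>"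
    if \<delta>: "\<delta> \<in> {delta_min n k..<1}" and P: "P \<in> P2_reg k" for \<delta> P
  proof -
    have P2: "P \<in> P2" using P by (simp add: P2_reg_def)
    have R: "real_distribution P" using P2 by (auto simp: P2_def)
    interpret prob_space "iid_sample P n" by (rule prob_space_iid_sample[OF R])
    have [measurable]: "E \<in> borel_measurable (iid_sample P n)"
      using E unfolding measurable_cong_sets[OF sets_iid_sample[OF R] refl] .
    obtain m where m: "1 \<le> m" "m \<le> n div k" "21 * (9/10) ^ m \<le> \<delta>" "real m \<le> 51 * (1 + ln (1 / \<delta>))"
      using block_number_for_confidence[OF k n \<delta>] .
    have pos: "0 \<le> 1 + ln (1 / \<delta>)"
    proof -
      have "0 \<le> a" if "real m \<le> 51 * a" for a using that m(1) by linarith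
      from this[OF m(4)] show ?thesis .
    qed
    have mn: "m \<le> n" using m(2) by (meson div_le_dividend le_trans)
    have q: "real n \<le> 2 * real m * real (n div m)"
    proof -
      have q1: "n div m \<ge> 1" using mn m(1) by (simp add: less_eq_div_iff_mult_less_eq)
      have "n = m * (n div m) + n mod m" by simp
      moreover have "n mod m \<le> m * 1" using m(1) by (simp add: less_imp_le)
      moreover have "m * 1 \<le> m * (n div m)" using q1 by (intro mult_le_mono2)
      ultimately have "n \<le> 2 * (m * (n div m))" by linarith
      then have "real n \<le> real (2 * (m * (n div m)))" by (rule of_nat_mono)
      then show ?thesis by simp
    qed
    have n0: "real n > 0" using mn m(1) by simp
    have q0: "real (n div m) > 0" using q n0 m(1) by (auto simp: zero_less_mult_iff intro: Nat.gr0I)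
    have "(32 / sqrt (real (n div m)))\<^sup>2 = 1024 / real (n div m)"
      using q0 by (simp add: power_divide)
    also have "\<dots> \<le> 2048 * real m / real n"
      using q q0 n0 by (simp add: field_simps)
    also have "\<dots> \<le> 2048 * (51 * (1 + ln (1 / \<delta>))) / real n"
      using m(4) n0 by (intro divide_right_mono) auto
    also have "\<dots> \<le> L_star\<^sup>2 * ((1 + ln (1 / \<delta>)) / real n)"
    proof -
      have "104448 * (1 + ln (1 / \<delta>)) \<le> L_star\<^sup>2 * (1 + ln (1 / \<delta>))"
        using L_star_bound(1) pos by (intro mult_right_mono) auto
      then have "104448 * (1 + ln (1 / \<delta>)) / real n \<le> L_star\<^sup>2 * (1 + ln (1 / \<delta>)) / real n"
        using n0 by (intro divide_right_mono) auto
      then show ?thesis by simp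
    qed
    also have "\<dots> = (L_star * sqrt ((1 + ln (1 / \<delta>)) / real n))\<^sup>2"
      using pos n0 by (subst power_mult_distrib) simp
    finally have "32 / sqrt (real (n div m)) \<le> L_star * sqrt ((1 + ln (1 / \<delta>)) / real n)"
      by (rule power2_le_imp_le) (use L_star_bound(2) pos n0 in \<open>auto intro!: mult_nonneg_nonneg\<close>)
    then have "dist_sd P * (32 / sqrt (real (n div m))) \<le> dist_sd P * (L_star * sqrt ((1 + ln (1 / \<delta>)) / real n))"
      using P2_properties(7)[OF P2] by (intro mult_left_mono) auto
    then have r: "32 * (dist_sd P / sqrt (real (n div m))) \<le> subgaussian_radius L_star P n \<delta>"
      by (simp add: subgaussian_radius_def mult_ac)
    have "prob {x \<in> space (iid_sample P n). \<bar>E x - dist_mean P\<bar> > subgaussian_radius L_star P n \<delta>} \<le>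
      prob {x \<in> space (iid_sample P n). \<bar>E x - dist_mean P\<bar> > 32 * (dist_sd P / sqrt (real (n div m)))}"
      using r by (intro finite_measure_mono) auto
    also have "\<dots> \<le> 21 * (9/10) ^ m" by (rule tail[OF P m(1,2)])
    also note m(3)
    finally show ?thesis .
  qed
  then show ?thesis using E unfolding multiple_delta_subgaussian_def by blast
qed

section \<open>Impossibility at very small confidence levels\<close>

definition finite_law :: "(real \<times> real) list \<Rightarrow> real measure" where
  "finite_law xs = distr (measure_pmf (pmf_of_list xs)) borel (\<lambda>x. x)"

lemma real_distribution_finite_law: "real_distribution (finite_law xs)"
  unfolding finite_law_def by (intro prob_space.real_distribution_distr prob_space_measure_pmf) auto

lemma sum_pmf_of_list:
  fixes g :: "real \<Rightarrow> real"
  assumes "finite A" "fst ` set xs \<subseteq> A"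
  shows "(\<Sum>a\<in>A. g a * sum_list (map snd (filter (\<lambda>z. fst z = a) xs))) = (\<Sum>(a, w)\<leftarrow>xs. g a * w)"
  using assms(2)
proof (induction xs)
  case (Cons z xs)
  have "(\<Sum>a\<in>A. g a * sum_list (map snd (filter (\<lambda>z. fst z = a) (z # xs)))) =
    (\<Sum>a\<in>A. (if fst z = a then g a * snd z else 0) + g a * sum_list (map snd (filter (\<lambda>z. fst z = a) xs)))"
    by (intro sum.cong) (auto simp: algebra_simps)
  also have "\<dots> = g (fst z) * snd z + (\<Sum>a\<in>A. g a * sum_list (map snd (filter (\<lambda>z. fst z = a) xs)))"
    using assms(1) Cons.prems by (simp add: sum.distrib sum.delta')
  finally show ?case using Cons by (simp add: case_prod_beta)
qed simp

lemma finite_law_integral: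
  fixes g :: "real \<Rightarrow> real"
  assumes xs: "pmf_of_list_wf xs" and g [measurable]: "g \<in> borel_measurable borel"
  shows "integrable (finite_law xs) g" "(LINT x|finite_law xs. g x) = (\<Sum>(a, w)\<leftarrow>xs. g a * w)"
proof -
  show "integrable (finite_law xs) g"
    unfolding finite_law_def by (simp add: integrable_distr_eq integrable_measure_pmf_finite finite_set_pmf_of_list[OF xs])
  have "(LINT x|finite_law xs. g x) = (\<integral>x. g x \<partial>measure_pmf (pmf_of_list xs))"
    unfolding finite_law_def by (simp add: integral_distr)
  also have "\<dots> = (\<Sum>a\<in>fst ` set xs. g a * pmf (pmf_of_list xs) a)"
    using set_pmf_of_list[OF xs] by (intro integral_measure_pmf_real) auto
  also have "\<dots> = (\<Sum>(a, w)\<leftarrow>xs. g a * w)"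
    unfolding pmf_pmf_of_list[OF xs] by (rule sum_pmf_of_list) auto
  finally show "(LINT x|finite_law xs. g x) = (\<Sum>(a, w)\<leftarrow>xs. g a * w)" .
qed

lemma finite_law_moments:
  assumes xs: "pmf_of_list_wf xs"
  shows "finite_law xs \<in> P2" "dist_mean (finite_law xs) = (\<Sum>(a, w)\<leftarrow>xs. a * w)"
    "(dist_sd (finite_law xs))\<^sup>2 = (\<Sum>(a, w)\<leftarrow>xs. (a - dist_mean (finite_law xs))\<^sup>2 * w)"
    "integrable (finite_law xs) (\<lambda>x. \<bar>x - dist_mean (finite_law xs)\<bar> powr \<alpha>)"
    "(LINT x|finite_law xs. \<bar>x - dist_mean (finite_law xs)\<bar> powr \<alpha>) =
      (\<Sum>(a, w)\<leftarrow>xs. \<bar>a - dist_mean (finite_law xs)\<bar> powr \<alpha> * w)"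
proof -
  show P2: "finite_law xs \<in> P2"
    using real_distribution_finite_law finite_law_integral(1)[OF xs, of "\<lambda>x. x\<^sup>2"] by (simp add: P2_def)
  show "dist_mean (finite_law xs) = (\<Sum>(a, w)\<leftarrow>xs. a * w)"
    unfolding dist_mean_def by (intro finite_law_integral(2)[OF xs]) simp
  show "(dist_sd (finite_law xs))\<^sup>2 = (\<Sum>(a, w)\<leftarrow>xs. (a - dist_mean (finite_law xs))\<^sup>2 * w)"
    unfolding P2_properties(6)[OF P2, symmetric] by (intro finite_law_integral(2)[OF xs]) simp
  show "integrable (finite_law xs) (\<lambda>x. \<bar>x - dist_mean (finite_law xs)\<bar> powr \<alpha>)"
    by (intro finite_law_integral(1)[OF xs]) simp
  show "(LINT x|finite_law xs. \<bar>x - dist_mean (finite_law xs)\<bar> powr \<alpha>) =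
      (\<Sum>(a, w)\<leftarrow>xs. \<bar>a - dist_mean (finite_law xs)\<bar> powr \<alpha> * w)"
    by (intro finite_law_integral(2)[OF xs]) simp
qed

lemma dirac_moments:
  "pmf_of_list_wf [(a, 1 :: real)]" "finite_law [(a, 1)] \<in> P2" "dist_mean (finite_law [(a, 1)]) = a"
  "dist_sd (finite_law [(a, 1)]) = 0"
proof -
  show wf: "pmf_of_list_wf [(a, 1 :: real)]" by (rule pmf_of_list_wfI) auto
  show "finite_law [(a, 1)] \<in> P2" by (rule finite_law_moments[OF wf])
  show m: "dist_mean (finite_law [(a, 1)]) = a" using finite_law_moments(2)[OF wf] by simp
  show "dist_sd (finite_law [(a, 1)]) = 0" using finite_law_moments(3)[OF wf] by (simp add: m)
qed

lemma dirac_in_P_moment: "finite_law [(a, 1)] \<in> P_moment \<alpha> \<eta>"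
  unfolding P_moment_def using dirac_moments[of a] finite_law_moments(4,5)[OF dirac_moments(1), of a \<alpha>] by simp

lemma iid_sample_point:
  assumes "real_distribution P"
  shows "measure (iid_sample P n) {\<lambda>i\<in>{..<n}. a} = measure P {a} ^ n" "{\<lambda>i\<in>{..<n}. a} \<in> sets (iid_sample P n)"
proof -
  interpret P: real_distribution P by fact
  interpret prod: product_sigma_finite "\<lambda>_. P" ..
  have eq: "{\<lambda>i\<in>{..<n}. a} = (\<Pi>\<^sub>E i\<in>{..<n}. {a})"
    by (auto simp: PiE_def Pi_def extensional_def fun_eq_iff)
  have a: "{a} \<in> sets P" by simp
  have "emeasure (iid_sample P n) {\<lambda>i\<in>{..<n}. a} = emeasure P {a} ^ n"
    unfolding iid_sample_def eq by (subst prod.emeasure_PiM) (auto simp: a)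
  then show "measure (iid_sample P n) {\<lambda>i\<in>{..<n}. a} = measure P {a} ^ n"
    by (intro measure_eq_emeasure_eq_ennreal) (simp_all add: P.emeasure_eq_measure ennreal_power)
  show "{\<lambda>i\<in>{..<n}. a} \<in> sets (iid_sample P n)"
    unfolding iid_sample_def eq using a by (intro sets_PiM_I_finite) auto
qed

text \<open>The point mass has radius \<open>0\<close>, and \<open>\<delta> < 1\<close>; so the estimator must answer \<open>a\<close> on the constant sample, which is a
  large error under \<open>P\<close>.\<close>

lemma no_estimator_from_heavy_atom:
  assumes P: "P \<in> \<P>\<^sub>0" "P \<in> P2" and dirac: "finite_law [(a, 1)] \<in> \<P>\<^sub>0"
    and \<delta>: "0 < \<delta>" "\<delta> < 1" and far: "subgaussian_radius L P n \<delta> < \<bar>a - dist_mean P\<bar>"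
    and atom: "\<delta> < measure P {a} ^ n"
  shows "\<not> (\<exists>E. delta_dependent_subgaussian L \<P>\<^sub>0 n \<delta> E)"
proof
  assume "\<exists>E. delta_dependent_subgaussian L \<P>\<^sub>0 n \<delta> E"
  then obtain E where E: "E \<in> borel_measurable
       ((\<Pi>\<^sub>M i\<in>{..<n}. (borel :: real measure)) \<Otimes>\<^sub>M restrict_space borel {\<delta>..<1})"
    and tail: "\<And>P. P \<in> \<P>\<^sub>0 \<Longrightarrow> \<P>(x in iid_sample P n. \<bar>E (x, \<delta>) - dist_mean P\<bar> > subgaussian_radius L P n \<delta>) \<le> \<delta>"
    using \<delta> unfolding delta_dependent_subgaussian_def by fastforce
  have E\<delta>: "(\<lambda>x. E (x, \<delta>)) \<in> borel_measurable (\<Pi>\<^sub>M i\<in>{..<n}. (borel :: real measure))"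
    by (rule measurable_compose[OF measurable_Pair2' E]) (use \<delta> in \<open>simp add: space_restrict_space\<close>)
  let ?z = "\<lambda>i\<in>{..<n}. a"
  have Ez: "E (?z, \<delta>) = a"
  proof (rule ccontr)
    assume ne: "E (?z, \<delta>) \<noteq> a"
    let ?Q = "finite_law [(a, 1)]"
    have R: "real_distribution ?Q" by (rule real_distribution_finite_law)
    interpret Q: prob_space "iid_sample ?Q n" by (rule prob_space_iid_sample[OF R])
    have [measurable]: "(\<lambda>x. E (x, \<delta>)) \<in> borel_measurable (iid_sample ?Q n)"
      using E\<delta> unfolding measurable_cong_sets[OF sets_iid_sample[OF R] refl] .
    have ae: "AE x in iid_sample ?Q n. \<bar>E (x, \<delta>) - a\<bar> > 0"
      using iid_sample_degenerate[OF dirac_moments(2)[of a] dirac_moments(4)[of a], of n] AE_space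
    proof eventually_elim
      case (elim x)
      then have "x = ?z" by (auto simp: dirac_moments iid_sample_def space_PiM PiE_def extensional_def fun_eq_iff)
      then show ?case using ne by simp
    qed
    have "Q.prob {x \<in> space (iid_sample ?Q n). \<bar>E (x, \<delta>) - a\<bar> > 0} = 1"
      using ae by (intro Q.prob_Collect_eq_1[THEN iffD2]) simp_all
    with tail[OF dirac] \<delta> show False
      by (simp add: subgaussian_radius_def dirac_moments)
  qed
  have R: "real_distribution P" using P(2) by (simp add: P2_def)
  interpret prob_space "iid_sample P n" by (rule prob_space_iid_sample[OF R])
  have [measurable]: "(\<lambda>x. E (x, \<delta>)) \<in> borel_measurable (iid_sample P n)"
    using E\<delta> unfolding measurable_cong_sets[OF sets_iid_sample[OF R] refl] .
  have "measure P {a} ^ n = prob {?z}" using iid_sample_point(1)[OF R] by simp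
  also have "\<dots> \<le> prob {x \<in> space (iid_sample P n). \<bar>E (x, \<delta>) - dist_mean P\<bar> > subgaussian_radius L P n \<delta>}"
  proof (rule finite_measure_mono)
    have "?z \<in> space (iid_sample P n)" using iid_sample_point(2)[OF R, of a n] sets.sets_into_space by blast
    then show "{?z} \<subseteq> {x \<in> space (iid_sample P n). \<bar>E (x, \<delta>) - dist_mean P\<bar> > subgaussian_radius L P n \<delta>}"
      using Ez far by auto
  qed measurable
  also have "\<dots> \<le> \<delta>" by (rule tail[OF P(1)])
  finally show False using atom by simp
qed

lemma exp_times_cube_le:
  fixes x :: real
  assumes "x \<ge> 2"
  shows "2 * exp (1 - 5 * x) * x ^ 3 \<le> 1/100"
proof -
  define y where "y = x - 2"
  have y: "y \<ge> 0" using assms by (simp add: y_def)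
  have "x ^ 3 \<le> (2 * exp y) ^ 3"
    using exp_ge_add_one_self[of y] y by (intro power_mono) (auto simp: y_def)
  also have "\<dots> = 8 * exp (3 * y)" by (simp add: power_mult_distrib exp_of_nat_mult[symmetric])
  also have "\<dots> \<le> 8 * exp (5 * y)" using y by simp
  finally have 1: "x ^ 3 \<le> 8 * exp (5 * y)" .
  \<comment> \<open>At \<open>x = 2\<close> the claim reads \<open>16 e\<^bsup>-9\<^esup> \<le> 1/100\<close>; the exponential decay wins beyond.\<close>
  have e9: "(1600 :: real) \<le> exp 9"
  proof -
    have "(5/2 :: real) \<le> exp 1" using exp_lower_Taylor_quadratic[of "1::real"] by simp
    then have "(5/2 :: real) ^ 9 \<le> exp 1 ^ 9" by (intro power_mono) auto
    also have "exp (1 :: real) ^ 9 = exp 9" by (simp add: exp_of_nat_mult[symmetric])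
    finally show ?thesis by (simp add: power_divide)
  qed
  have "2 * exp (1 - 5 * x) * x ^ 3 \<le> 2 * exp (1 - 5 * x) * (8 * exp (5 * y))"
    using 1 by (intro mult_left_mono) auto
  also have "\<dots> = 16 * exp (1 - 5 * x + 5 * y)" by (simp add: exp_add)
  also have "1 - 5 * x + 5 * y = - 9" by (simp add: y_def)
  also have "16 * exp (- 9) \<le> (1/100 :: real)" using e9 by (simp add: exp_minus field_simps)
  finally show ?thesis .
qed

text \<open>With \<open>x = L\<^sup>2\<close> the witness puts mass \<open>q = 2 e\<^bsup>1 - 5x\<^esup>\<close> at \<open>-M\<close>, where \<open>M = 3x\<close>, and shares the rest equally between \<open>-1\<close> and \<open>1\<close>.
  The factor \<open>2\<close> makes \<open>q\<^sup>n\<close> exceed \<open>\<delta> = e\<^bsup>1 - 5xn\<^esup>\<close> strictly.  At this \<open>\<delta>\<close> the radius is \<open>\<surd>5 x \<sigma>\<close> with \<open>\<sigma>\<close> close to \<open>1\<close>,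
  and \<open>3 > \<surd>5\<close>.  The atom hardly affects the moments because \<open>q x\<^sup>3\<close> is tiny.\<close>

theorem no_delta_dependent_estimator:
  assumes \<alpha>: "2 < \<alpha>" "\<alpha> \<le> 3" and \<eta>: "\<eta> \<ge> 7/5" and L: "L \<ge> sqrt 2" and n: "n \<ge> 1"
  shows "\<not> (\<exists>E. delta_dependent_subgaussian L (P_moment \<alpha> \<eta>) n (exp (1 - 5 * L\<^sup>2 * real n)) E)"
proof -
  define x where "x = L\<^sup>2"
  have L0: "L > 0" using L by (meson less_le_trans real_sqrt_gt_zero zero_less_numeral)
  have x: "x \<ge> 2" using power_mono[OF L, of 2] by (simp add: x_def)
  define q where "q = 2 * exp (1 - 5 * x)"
  define M where "M = 3 * x"
  have q0: "q > 0" by (simp add: q_def)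
  have qx3: "q * x ^ 3 \<le> 1/100" using exp_times_cube_le[OF x] by (simp add: q_def)
  have qx2: "q * x\<^sup>2 \<le> 1/200"
  proof -
    have "q * x\<^sup>2 * 2 \<le> q * x\<^sup>2 * x" using x q0 by (intro mult_left_mono) auto
    also have "\<dots> = q * x ^ 3" by (simp add: power3_eq_cube power2_eq_square)
    finally show ?thesis using qx3 by linarith
  qed
  have qx: "q * x \<le> 1/400"
  proof -
    have "q * x * 2 \<le> q * x * x" using x q0 by (intro mult_left_mono) auto
    also have "\<dots> = q * x\<^sup>2" by (simp add: power2_eq_square)
    finally show ?thesis using qx2 by linarith
  qed
  have q1: "q \<le> 1/800"
  proof -
    have "q * 2 \<le> q * x" using x q0 by (intro mult_left_mono) auto
    then show ?thesis using qx by linarith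
  qed
  define xs where "xs = [(- M, q), (- 1, (1 - q) / 2), (1, (1 - q) / 2)]"
  have wf: "pmf_of_list_wf xs" unfolding xs_def pmf_of_list_wf_def using q0 q1 by auto
  let ?P = "finite_law xs"
  have mean: "dist_mean ?P = - (q * M)"
    unfolding finite_law_moments(2)[OF wf] by (simp add: xs_def field_simps)
  have var: "(dist_sd ?P)\<^sup>2 = (1 - q) * (1 + q * M\<^sup>2)"
    unfolding finite_law_moments(3)[OF wf] mean
    by (simp add: xs_def power2_eq_square) (simp add: field_simps)
  have M: "M \<ge> 6" using x by (simp add: M_def)
  have M2: "M\<^sup>2 = 9 * x\<^sup>2" by (simp add: M_def power_mult_distrib)
  have sd1: "dist_sd ?P \<ge> 1"
  proof -
    have "36 \<le> M\<^sup>2" using power_mono[of 6 M 2] M by simp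
    then have "1 \<le> M\<^sup>2 * (1 - q)" using q1 mult_mono[of 36 "M\<^sup>2" "1/2" "1 - q"] by simp
    then have "0 \<le> q * (M\<^sup>2 * (1 - q) - 1)" using q0 by simp
    then have "1\<^sup>2 \<le> (dist_sd ?P)\<^sup>2" unfolding var by (simp add: algebra_simps)
    then show ?thesis by (rule power2_le_imp_le) (rule P2_properties(7)[OF finite_law_moments(1)[OF wf]])
  qed
  have mem: "?P \<in> P_moment \<alpha> \<eta>"
  proof -
    have le: "y powr \<alpha> \<le> z ^ 3" if "0 \<le> y" "y \<le> z" "1 \<le> z" for y z :: real
    proof -
      have "y powr \<alpha> \<le> z powr \<alpha>" using that \<alpha> by (intro powr_mono2) auto
      also have "\<dots> \<le> z powr 3" using that \<alpha> by (intro powr_mono) auto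
      finally show ?thesis using that by (simp add: powr_numeral)
    qed
    have qM: "q * M \<le> 3/400" "q * M \<ge> 0" using qx q0 x by (simp_all add: M_def)
    have qM3: "q * M ^ 3 \<le> 27/100" using qx3 by (simp add: M_def power_mult_distrib)
    have t1: "\<bar>- M + q * M\<bar> powr \<alpha> * q \<le> M ^ 3 * q"
      using M qM q0 by (intro mult_right_mono le) (simp, linarith, linarith, simp)
    have t2: "\<bar>- 1 + q * M\<bar> powr \<alpha> * ((1 - q) / 2) \<le> (403/400) ^ 3 * (1/2)"
      using qM q0 q1 by (intro mult_mono le) auto
    have t3: "\<bar>1 + q * M\<bar> powr \<alpha> * ((1 - q) / 2) \<le> (403/400) ^ 3 * (1/2)"
      using qM q0 q1 by (intro mult_mono le) auto
    have "(LINT x|?P. \<bar>x - dist_mean ?P\<bar> powr \<alpha>) = \<bar>- M + q * M\<bar> powr \<alpha> * q +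
      (\<bar>- 1 + q * M\<bar> powr \<alpha> * ((1 - q) / 2) + \<bar>1 + q * M\<bar> powr \<alpha> * ((1 - q) / 2))"
      by (subst finite_law_moments(5)[OF wf], unfold mean) (simp add: xs_def)
    also have "\<dots> \<le> M ^ 3 * q + ((403/400) ^ 3 * (1/2) + (403/400) ^ 3 * (1/2))"
      by (intro add_mono t1 t2 t3)
    also have "\<dots> \<le> 7/5" using qM3 by (simp add: power_divide mult.commute)
    also have "\<dots> \<le> \<eta> * dist_sd ?P" using mult_mono[OF \<eta> sd1] \<eta> by simp
    also have "\<dots> = (\<eta> * dist_sd ?P) powr 1" using \<eta> sd1 by simp
    also have "\<dots> \<le> (\<eta> * dist_sd ?P) powr \<alpha>"
      using mult_mono[OF \<eta> sd1] \<eta> \<alpha> by (intro powr_mono) auto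
    finally show ?thesis unfolding P_moment_def using finite_law_moments(1,4)[OF wf] by simp
  qed
  have atom: "measure ?P {- M} = q"
  proof -
    have "measure ?P {- M} = measure (pmf_of_list xs) {- M}"
      unfolding finite_law_def by (subst measure_distr) auto
    then show ?thesis unfolding measure_pmf_of_list[OF wf] using M by (simp add: xs_def)
  qed
  define \<delta> where "\<delta> = exp (1 - 5 * L\<^sup>2 * real n)"
  have ln\<delta>: "1 + ln (1 / \<delta>) = 5 * x * real n" by (simp add: \<delta>_def x_def ln_div)
  show ?thesis
  proof (rule no_estimator_from_heavy_atom[OF mem finite_law_moments(1)[OF wf] dirac_in_P_moment[of "- M"]])
    show "0 < exp (1 - 5 * L\<^sup>2 * real n)" by simp
    have "5 * 2 * 1 \<le> 5 * L\<^sup>2 * real n" using x n by (intro mult_mono) (auto simp: x_def)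
    then have "1 - 5 * L\<^sup>2 * real n < 0" by linarith
    then show "exp (1 - 5 * L\<^sup>2 * real n) < 1" by (simp only: exp_less_one_iff)
    have "exp (1 - 5 * L\<^sup>2 * real n) = exp 1 * exp (- 5 * x) ^ n"
      by (simp add: exp_diff exp_minus x_def exp_of_nat_mult[symmetric] field_simps)
    also have "\<dots> < (2 * exp 1) ^ n * exp (- 5 * x) ^ n"
    proof (intro mult_strict_right_mono)
      have "exp 1 * 1 < exp 1 * (2 :: real)" by simp
      also have "\<dots> = (2 * exp 1) ^ 1" by simp
      also have "\<dots> \<le> (2 * exp 1) ^ n" using n exp_ge_add_one_self[of "1 :: real"]
        by (intro power_increasing) linarith+
      finally show "exp 1 < (2 * exp 1 :: real) ^ n" by simp
    qed simp
    also have "\<dots> = q ^ n"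
    proof -
      have "q = 2 * exp 1 * exp (- 5 * x)" by (simp add: q_def exp_add[symmetric])
      then show ?thesis by (simp only: power_mult_distrib)
    qed
    finally show "exp (1 - 5 * L\<^sup>2 * real n) < measure ?P {- M} ^ n" by (simp add: atom)
    have "subgaussian_radius L ?P n \<delta> = L * dist_sd ?P * sqrt (5 * x)"
      unfolding subgaussian_radius_def ln\<delta> using n by simp
    also have "\<dots> < M * (1 - q)"
    proof (rule power2_less_imp_less)
      have "(L * dist_sd ?P * sqrt (5 * x))\<^sup>2 = x * ((1 - q) * (1 + q * M\<^sup>2)) * (5 * x)"
        using x by (simp add: power_mult_distrib var x_def[symmetric])
      also have "\<dots> = (1 - q) * x\<^sup>2 * (5 + 45 * (q * x\<^sup>2))"
        unfolding M2 by (simp add: algebra_simps power2_eq_square)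
      also have "\<dots> < (1 - q) * x\<^sup>2 * (9 * (1 - q))"
        using q1 qx2 x by (intro mult_strict_left_mono mult_pos_pos) auto
      also have "\<dots> = (M * (1 - q))\<^sup>2" unfolding power_mult_distrib M2 by (simp add: power2_eq_square)
      finally show "(L * dist_sd ?P * sqrt (5 * x))\<^sup>2 < (M * (1 - q))\<^sup>2" .
      show "0 \<le> M * (1 - q)" using M q1 by (intro mult_nonneg_nonneg) auto
    qed
    also have "\<dots> = \<bar>- M - dist_mean ?P\<bar>"
    proof -
      have "M * (1 - q) \<ge> 0" using M q1 by (intro mult_nonneg_nonneg) auto
      moreover have "- M - dist_mean ?P = - (M * (1 - q))" by (simp add: mean algebra_simps)
      ultimately show ?thesis by simp
    qed
    finally show "subgaussian_radius L ?P n (exp (1 - 5 * L\<^sup>2 * real n)) < \<bar>- M - dist_mean ?P\<bar>"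
      by (simp add: \<delta>_def)
  qed
qed

lemma multiple_delta_imp_delta_dependent:
  assumes "multiple_delta_subgaussian L \<P>\<^sub>0 n \<delta>min E" and "\<delta>min \<le> \<delta>"
  shows "delta_dependent_subgaussian L \<P>\<^sub>0 n \<delta> (\<lambda>z. E (fst z))"
proof -
  have "(\<lambda>z. E (fst z)) \<in> borel_measurable ((\<Pi>\<^sub>M i\<in>{..<n}. (borel :: real measure)) \<Otimes>\<^sub>M restrict_space borel {\<delta>..<1})"
    using assms(1) unfolding multiple_delta_subgaussian_def
    by (intro measurable_compose[OF measurable_fst]) auto
  then show ?thesis
    using assms unfolding multiple_delta_subgaussian_def delta_dependent_subgaussian_def by auto
qed

section \<open>Bernoulli laws and change of measure\<close>

text \<open>The two measures agree on boxes, where the integral of a product factorises.\<close>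

lemma PiM_density:
  fixes M :: "'i \<Rightarrow> 'a measure" and f :: "'i \<Rightarrow> 'a \<Rightarrow> ennreal"
  assumes I: "finite I" and M: "\<And>i. prob_space (M i)" and f [measurable]: "\<And>i. f i \<in> borel_measurable (M i)"
    and D: "\<And>i. prob_space (density (M i) (f i))"
  shows "PiM I (\<lambda>i. density (M i) (f i)) = density (PiM I M) (\<lambda>x. \<Prod>i\<in>I. f i (x i))"
proof -
  interpret M: prob_space "M i" for i by (rule M)
  interpret D: prob_space "density (M i) (f i)" for i by (rule D)
  interpret PM: product_sigma_finite M ..
  interpret PD: product_sigma_finite "\<lambda>i. density (M i) (f i)" ..
  have fm: "(\<lambda>x. \<Prod>i\<in>I. f i (x i)) \<in> borel_measurable (PiM I M)"
    by (intro borel_measurable_prod_ennreal) measurable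
  show ?thesis
  proof (rule PD.PiM_eqI[OF I, symmetric])
    show "sets (density (PiM I M) (\<lambda>x. \<Prod>i\<in>I. f i (x i))) = sets (PiM I (\<lambda>i. density (M i) (f i)))"
      by (simp cong: sets_PiM_cong)
    fix A assume "\<And>i. i \<in> I \<Longrightarrow> A i \<in> sets (density (M i) (f i))"
    then have A: "\<And>i. i \<in> I \<Longrightarrow> A i \<in> sets (M i)" by simp
    have "emeasure (density (PiM I M) (\<lambda>x. \<Prod>i\<in>I. f i (x i))) (Pi\<^sub>E I A) =
      (\<integral>\<^sup>+x. (\<Prod>i\<in>I. f i (x i)) * indicator (Pi\<^sub>E I A) x \<partial>PiM I M)"
      using fm A I by (intro emeasure_density sets_PiM_I_finite) auto
    also have "\<dots> = (\<integral>\<^sup>+x. (\<Prod>i\<in>I. f i (x i) * indicator (A i) (x i)) \<partial>PiM I M)"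
    proof (intro nn_integral_cong)
      fix x assume "x \<in> space (PiM I M)"
      then have "indicator (Pi\<^sub>E I A) x = (\<Prod>i\<in>I. indicator (A i) (x i) :: ennreal)"
        using I by (auto simp: indicator_def PiE_def space_PiM Pi_def prod_zero_iff)
      then show "(\<Prod>i\<in>I. f i (x i)) * indicator (Pi\<^sub>E I A) x = (\<Prod>i\<in>I. f i (x i) * indicator (A i) (x i))"
        by (simp add: prod.distrib)
    qed
    also have "\<dots> = (\<Prod>i\<in>I. \<integral>\<^sup>+x. f i x * indicator (A i) x \<partial>M i)"
      using A by (intro PM.product_nn_integral_prod I borel_measurable_times_ennreal borel_measurable_indicator f) auto
    also have "\<dots> = (\<Prod>i\<in>I. emeasure (density (M i) (f i)) (A i))"
      using A by (intro prod.cong refl emeasure_density[symmetric]) auto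
    finally show "emeasure (density (PiM I M) (\<lambda>x. \<Prod>i\<in>I. f i (x i))) (Pi\<^sub>E I A) =
      (\<Prod>i\<in>I. emeasure (density (M i) (f i)) (A i))" .
  qed
qed

definition bernoulli_law :: "real \<Rightarrow> real measure" where
  "bernoulli_law p = finite_law [(1, p), (0, 1 - p)]"

lemma bernoulli_list_wf: "0 \<le> p \<Longrightarrow> p \<le> 1 \<Longrightarrow> pmf_of_list_wf [(1 :: real, p), (0, 1 - p)]" for p :: real
  by (rule pmf_of_list_wfI) auto

lemma bernoulli_law_moments:
  assumes p: "0 \<le> p" "p \<le> 1"
  shows "bernoulli_law p \<in> P2" "dist_mean (bernoulli_law p) = p" "(dist_sd (bernoulli_law p))\<^sup>2 = p * (1 - p)"
proof -
  note wf = bernoulli_list_wf[OF p]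
  show "bernoulli_law p \<in> P2" unfolding bernoulli_law_def by (rule finite_law_moments[OF wf])
  show m: "dist_mean (bernoulli_law p) = p"
    unfolding bernoulli_law_def finite_law_moments(2)[OF wf] by simp
  show "(dist_sd (bernoulli_law p))\<^sup>2 = p * (1 - p)"
    using finite_law_moments(3)[OF wf] m unfolding bernoulli_law_def
    by (simp add: power2_eq_square algebra_simps)
qed

text \<open>On the support \<open>\<bar>x - p\<bar> \<le> 1\<close>, so the \<open>\<alpha>\<close>-th central moment is at most the variance \<open>V\<close>; and \<open>V \<le> \<eta>\<^sup>\<alpha> V\<^bsup>\<alpha>/2\<^esup>\<close> says exactly that \<open>V\<close> is at least
  \<open>\<eta>\<^bsup>-2\<alpha>/(\<alpha> - 2)\<^esup>\<close>.\<close>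

lemma bernoulli_law_in_P_moment:
  assumes \<alpha>: "2 < \<alpha>" and \<eta>: "\<eta> > 0" and p: "0 < p" "p < 1" and v: "\<eta> powr (- 2 * \<alpha> / (\<alpha> - 2)) \<le> p * (1 - p)"
  shows "bernoulli_law p \<in> P_moment \<alpha> \<eta>"
proof -
  have wf: "pmf_of_list_wf [(1 :: real, p), (0, 1 - p)]" using p by (intro bernoulli_list_wf) auto
  define V where "V = p * (1 - p)"
  have V: "V > 0" using p by (simp add: V_def)
  have mean: "dist_mean (bernoulli_law p) = p" and sd2: "(dist_sd (bernoulli_law p))\<^sup>2 = V"
    using bernoulli_law_moments[of p] p by (auto simp: V_def)
  have sd: "dist_sd (bernoulli_law p) = sqrt V"
    using P2_properties(7)[OF bernoulli_law_moments(1)[of p]] p sd2 by (intro real_sqrt_unique[symmetric]) auto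
  have le: "y powr \<alpha> \<le> y\<^sup>2" if "0 < y" "y < 1" for y :: real
    using powr_mono'[of 2 \<alpha> y] \<alpha> that by (simp add: powr_numeral)
  have "(LINT x|bernoulli_law p. \<bar>x - dist_mean (bernoulli_law p)\<bar> powr \<alpha>) = (1 - p) powr \<alpha> * p + p powr \<alpha> * (1 - p)"
    using finite_law_moments(5)[OF wf, of \<alpha>] mean p unfolding bernoulli_law_def by simp
  also have "\<dots> \<le> (1 - p)\<^sup>2 * p + p\<^sup>2 * (1 - p)"
    using p by (intro add_mono mult_right_mono le) auto
  also have "\<dots> = V" by (simp add: V_def power2_eq_square algebra_simps)
  also have "V \<le> \<eta> powr \<alpha> * V powr (\<alpha> / 2)"
  proof -
    have "\<eta> powr (- \<alpha>) = (\<eta> powr (- 2 * \<alpha> / (\<alpha> - 2))) powr ((\<alpha> - 2) / 2)"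
    proof -
      have "- 2 * \<alpha> / (\<alpha> - 2) * ((\<alpha> - 2) / 2) = - \<alpha>" using \<alpha> by (simp add: field_simps)
      then show ?thesis by (simp only: powr_powr)
    qed
    also have "\<dots> \<le> V powr ((\<alpha> - 2) / 2)"
      using v \<alpha> unfolding V_def by (intro powr_mono2) auto
    finally have "\<eta> powr \<alpha> * \<eta> powr (- \<alpha>) * V \<le> \<eta> powr \<alpha> * V powr ((\<alpha> - 2) / 2) * V"
      using V by (intro mult_right_mono mult_left_mono) auto
    moreover have "\<eta> powr \<alpha> * \<eta> powr (- \<alpha>) = 1" using \<eta> by (simp add: powr_add[symmetric])
    moreover have "V powr (\<alpha> / 2) = V powr ((\<alpha> - 2) / 2) * V"
    proof -
      have "\<alpha> / 2 = (\<alpha> - 2) / 2 + 1" by (simp add: field_simps)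
      then show ?thesis using V by (metis powr_add powr_one less_imp_le)
    qed
    ultimately show ?thesis by simp
  qed
  also have "\<dots> = (\<eta> * dist_sd (bernoulli_law p)) powr \<alpha>"
  proof -
    have "sqrt V powr \<alpha> = V powr (\<alpha> / 2)" using V by (simp add: powr_half_sqrt[symmetric] powr_powr)
    then show ?thesis unfolding sd using \<eta> V by (subst powr_mult) auto
  qed
  finally show ?thesis
    using finite_law_moments(1,4)[OF wf] unfolding P_moment_def bernoulli_law_def by simp
qed

lemma nn_integral_bernoulli_law:
  fixes g :: "real \<Rightarrow> ennreal"
  assumes p: "0 \<le> p" "p \<le> 1" and g [measurable]: "g \<in> borel_measurable borel"
  shows "(\<integral>\<^sup>+x. g x \<partial>bernoulli_law p) = g 1 * ennreal p + g 0 * ennreal (1 - p)"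
proof -
  note wf = bernoulli_list_wf[OF p]
  have "(\<integral>\<^sup>+x. g x \<partial>bernoulli_law p) = (\<integral>\<^sup>+x. g x \<partial>measure_pmf (pmf_of_list [(1, p), (0, 1 - p)]))"
    unfolding bernoulli_law_def finite_law_def by (simp add: nn_integral_distr)
  also have "\<dots> = (\<Sum>x\<in>{1, 0}. g x * ennreal (pmf (pmf_of_list [(1, p), (0, 1 - p)]) x))"
    using set_pmf_of_list[OF wf] by (intro nn_integral_measure_pmf_support) auto
  also have "\<dots> = g 1 * ennreal p + g 0 * ennreal (1 - p)"
    by (simp add: pmf_pmf_of_list[OF wf])
  finally show ?thesis .
qed

lemma real_distribution_bernoulli_law: "real_distribution (bernoulli_law p)"
  unfolding bernoulli_law_def by (rule real_distribution_finite_law)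

text \<open>Writing the likelihood ratio as an exponential in \<open>x\<close> makes the ratio for a whole sample depend on the sum of the sample only.\<close>

lemma bernoulli_law_tilting:
  assumes p: "0 < p" "p < 1" and p': "0 < p'" "p' < 1"
  defines "B \<equiv> p' * (1 - p) / (p * (1 - p'))"
  shows "bernoulli_law p' = density (bernoulli_law p) (\<lambda>x. ennreal ((1 - p') / (1 - p) * B powr x))"
proof (rule measure_eqI)
  have sets [simp]: "sets (bernoulli_law q) = sets borel" for q
    using real_distribution_bernoulli_law by (simp add: real_distribution.events_eq_borel)
  show "sets (bernoulli_law p') = sets (density (bernoulli_law p) (\<lambda>x. ennreal ((1 - p') / (1 - p) * B powr x)))"
    by simp
  have B: "B > 0" using p p' by (simp add: B_def)
  fix X assume "X \<in> sets (bernoulli_law p')"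
  then have X [measurable]: "X \<in> sets borel" by simp
  have "emeasure (density (bernoulli_law p) (\<lambda>x. ennreal ((1 - p') / (1 - p) * B powr x))) X =
    (\<integral>\<^sup>+x. ennreal ((1 - p') / (1 - p) * B powr x) * indicator X x \<partial>bernoulli_law p)"
    by (intro emeasure_density) (simp_all cong: measurable_cong_sets)
  also have "\<dots> = ennreal ((1 - p') / (1 - p) * B powr 1) * indicator X 1 * ennreal p +
      ennreal ((1 - p') / (1 - p) * B powr 0) * indicator X 0 * ennreal (1 - p)"
    using p by (intro nn_integral_bernoulli_law) auto
  also have "\<dots> = indicator X 1 * ennreal ((1 - p') / (1 - p) * B * p) + indicator X 0 * ennreal ((1 - p') / (1 - p) * (1 - p))"
  proof -
    have "ennreal k * i * ennreal w = i * ennreal (k * w)" if "k \<ge> 0" "w \<ge> 0" for k w :: real and i :: ennreal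
      using that by (simp add: ennreal_mult mult_ac)
    then show ?thesis using p p' B by simp
  qed
  also have "(1 - p') / (1 - p) * B * p = p'" using p p' by (simp add: B_def)
  also have "(1 - p') / (1 - p) * (1 - p) = 1 - p'" using p by simp
  also have "indicator X 1 * ennreal p' + indicator X 0 * ennreal (1 - p') = (\<integral>\<^sup>+x. indicator X x \<partial>bernoulli_law p')"
    using p' by (subst nn_integral_bernoulli_law) auto
  also have "\<dots> = emeasure (bernoulli_law p') X"
    by (subst nn_integral_indicator) auto
  finally show "emeasure (bernoulli_law p') X = emeasure (density (bernoulli_law p) (\<lambda>x. ennreal ((1 - p') / (1 - p) * B powr x))) X" ..
qed

text \<open>The likelihood ratio of a sample with sum at most \<open>s\<close> is at most \<open>B\<^sup>s\<close>, where the odds ratio \<open>B\<close> is at most \<open>2 p'/p\<close>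
  since \<open>p' \<le> 1/2\<close>.\<close>

lemma bernoulli_change_of_measure:
  assumes p: "0 < p" "p \<le> p'" "p' \<le> 1/2" and G: "G \<in> sets (iid_sample (bernoulli_law p) n)"
    and s: "0 \<le> s" "\<And>x. x \<in> G \<Longrightarrow> (\<Sum>i<n. x i) \<le> s"
  shows "measure (iid_sample (bernoulli_law p') n) G \<le> (2 * (p' / p)) powr s * measure (iid_sample (bernoulli_law p) n) G"
proof -
  define B where "B = p' * (1 - p) / (p * (1 - p'))"
  define c where "c = (1 - p') / (1 - p)"
  let ?f = "\<lambda>x. ennreal (c * B powr x)"
  have R: "real_distribution (bernoulli_law q)" for q by (rule real_distribution_bernoulli_law)
  have sets [simp]: "sets (bernoulli_law q) = sets borel" for q
    using R by (simp add: real_distribution.events_eq_borel)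
  have tilt: "bernoulli_law p' = density (bernoulli_law p) ?f"
    unfolding B_def c_def using p by (intro bernoulli_law_tilting) auto
  have pp: "prob_space (bernoulli_law q)" for q using R by (simp add: real_distribution_def)
  interpret I: prob_space "iid_sample (bernoulli_law p) n" by (rule prob_space_iid_sample[OF R])
  interpret I': prob_space "iid_sample (bernoulli_law p') n" by (rule prob_space_iid_sample[OF R])
  have fm: "?f \<in> borel_measurable (bernoulli_law p)" by (simp cong: measurable_cong_sets)
  have prod: "iid_sample (bernoulli_law p') n = density (iid_sample (bernoulli_law p) n) (\<lambda>x. \<Prod>i<n. ?f (x i))"
    unfolding iid_sample_def tilt
    using pp fm pp[of p', unfolded tilt] by (intro PiM_density) auto
  have c: "0 \<le> c" "c \<le> 1" using p by (auto simp: c_def)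
  have B1: "1 \<le> B"
  proof -
    have "p * (1 - p') \<le> p' * (1 - p)" using p by (simp add: algebra_simps)
    moreover have "p * (1 - p') > 0" using p by simp
    ultimately show ?thesis by (simp add: B_def)
  qed
  have B2: "B \<le> 2 * (p' / p)"
  proof -
    have "B = p' / p * ((1 - p) / (1 - p'))" by (simp add: B_def)
    also have "\<dots> \<le> p' / p * 2" using p by (intro mult_left_mono) (auto simp: divide_le_eq)
    finally show ?thesis by (simp only: mult.commute)
  qed
  have le: "(\<Prod>i<n. ?f (x i)) \<le> ennreal ((2 * (p' / p)) powr s)" if "x \<in> G" for x
  proof -
    have "(\<Prod>i<n. ?f (x i)) = ennreal (\<Prod>i<n. c * B powr x i)"
      using c by (intro prod_ennreal) auto
    also have "(\<Prod>i<n. c * B powr x i) = c ^ n * B powr (\<Sum>i<n. x i)"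
      using B1 by (simp add: prod.distrib powr_sum)
    also have "\<dots> \<le> 1 * B powr s"
      using c B1 s(2)[OF that] by (intro mult_mono power_le_one powr_mono) auto
    also have "\<dots> \<le> (2 * (p' / p)) powr s"
      using B1 B2 s(1) by (simp add: powr_mono2)
    finally show ?thesis by (simp add: ennreal_leI)
  qed
  have meas: "(\<lambda>x. \<Prod>i<n. ?f (x i)) \<in> borel_measurable (iid_sample (bernoulli_law p) n)"
  proof (intro borel_measurable_prod_ennreal)
    fix i assume "i \<in> {..<n}"
    then have [measurable]: "(\<lambda>x. x i) \<in> borel_measurable (iid_sample (bernoulli_law p) n)"
      using measurable_iid_coordinate[OF R] by simp
    show "(\<lambda>x. ?f (x i)) \<in> borel_measurable (iid_sample (bernoulli_law p) n)" by measurable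
  qed
  have "emeasure (iid_sample (bernoulli_law p') n) G = (\<integral>\<^sup>+x. (\<Prod>i<n. ?f (x i)) * indicator G x \<partial>iid_sample (bernoulli_law p) n)"
    unfolding prod using G meas by (intro emeasure_density) auto
  also have "\<dots> \<le> (\<integral>\<^sup>+x. ennreal ((2 * (p' / p)) powr s) * indicator G x \<partial>iid_sample (bernoulli_law p) n)"
    using le by (intro nn_integral_mono) (auto split: split_indicator)
  also have "\<dots> = ennreal ((2 * (p' / p)) powr s) * emeasure (iid_sample (bernoulli_law p) n) G"
    using G by (subst nn_integral_cmult_indicator) auto
  finally show ?thesis
    by (simp add: I.emeasure_eq_measure I'.emeasure_eq_measure ennreal_mult[symmetric])
qed

section \<open>Impossibility of estimation for all confidence levels at once\<close>

text \<open>Let \<open>t = n A p\<close>, \<open>l = ln (2A)\<close> and \<open>G\<close> the event that \<open>E > A p / 2\<close> and the sum of the sample is at most \<open>4t\<close>.  Accuracy at level \<open>1/4\<close> under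
  the parameter \<open>A p\<close> and Chebyshev's inequality give \<open>G\<close> probability at least \<open>1/2\<close> there, hence at least \<open>e\<^bsup>-4tl\<^esup> / 2\<close> under \<open>p\<close>.
  Accuracy at level \<open>\<delta> = e\<^bsup>-5tl\<^esup>\<close> under \<open>p\<close> allows at most \<open>\<delta>\<close>.\<close>

lemma no_multiple_delta_estimator_bernoulli:
  assumes p: "p > 0" "A * p \<le> 1/2" and A: "A \<ge> 2" and L: "L \<ge> 1"
    and mem: "bernoulli_law p \<in> \<P>\<^sub>0" "bernoulli_law (A * p) \<in> \<P>\<^sub>0"
    and AL: "1 + L * sqrt (10 * A * ln (2 * A)) < A / 2"
    and n: "4 * L\<^sup>2 * (1 + ln 4) < real n * (A * p)"
    and \<delta>min: "\<delta>min \<le> exp (- 5 * A * ln (2 * A) * (real n * p))"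
  shows "\<not> (\<exists>E. multiple_delta_subgaussian L \<P>\<^sub>0 n \<delta>min E)"
proof
  assume "\<exists>E. multiple_delta_subgaussian L \<P>\<^sub>0 n \<delta>min E"
  then obtain E where E: "E \<in> borel_measurable (\<Pi>\<^sub>M i\<in>{..<n}. (borel :: real measure))"
    and tail: "\<And>\<delta> P. \<delta>min \<le> \<delta> \<Longrightarrow> \<delta> < 1 \<Longrightarrow> P \<in> \<P>\<^sub>0 \<Longrightarrow>
      \<P>(x in iid_sample P n. \<bar>E x - dist_mean P\<bar> > subgaussian_radius L P n \<delta>) \<le> \<delta>"
    unfolding multiple_delta_subgaussian_def by auto
  define t where "t = real n * (A * p)"
  define l where "l = ln (2 * A)"
  let ?P = "bernoulli_law p" and ?Q = "bernoulli_law (A * p)"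
  have pA: "p \<le> A * p" using p A mult_right_mono[of 1 A p] by simp
  have p1: "p \<le> 1/2" using p pA by linarith
  have A0: "A * p > 0" using p A by simp
  have l4: "ln 4 \<le> l" unfolding l_def using A by (subst ln_le_cancel_iff) auto
  have ln4: "ln 4 \<ge> (1 :: real)" using ln_realpow[of 2 2] ln2_ge_two_thirds by simp
  have l1: "l \<ge> 1" using l4 ln4 by linarith
  have L2: "L\<^sup>2 \<ge> 1" using power_mono[OF L, of 2] by simp
  have t: "t > 8"
  proof -
    have "4 * 1 * 2 \<le> 4 * L\<^sup>2 * (1 + ln 4)" using L2 ln4 by (intro mult_mono) auto
    then show ?thesis using n by (simp add: t_def)
  qed
  have n0: "real n > 0" using t A0 by (auto simp: t_def intro: Nat.gr0I)
  have mean: "dist_mean ?P = p" "dist_mean ?Q = A * p" and P2: "?P \<in> P2" "?Q \<in> P2"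
    and var: "(dist_sd ?P)\<^sup>2 \<le> p" "(dist_sd ?Q)\<^sup>2 \<le> A * p"
    using bernoulli_law_moments[of p] bernoulli_law_moments[of "A * p"] p p1 A0
    by (auto intro!: mult_left_le)
  have sd: "dist_sd ?P \<le> sqrt p" "dist_sd ?Q \<le> sqrt (A * p)"
    using var by (auto intro: real_le_rsqrt)
  have R: "real_distribution ?P" "real_distribution ?Q" by (rule real_distribution_bernoulli_law)+
  interpret P: prob_space "iid_sample ?P n" by (rule prob_space_iid_sample[OF R(1)])
  interpret Q: prob_space "iid_sample ?Q n" by (rule prob_space_iid_sample[OF R(2)])
  have [measurable]: "E \<in> borel_measurable (iid_sample ?P n)" "E \<in> borel_measurable (iid_sample ?Q n)"
    using E unfolding measurable_cong_sets[OF sets_iid_sample[OF R(1)] refl] measurable_cong_sets[OF sets_iid_sample[OF R(2)] refl] by auto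
  note [measurable] = measurable_iid_sum[OF R(1)] measurable_iid_sum[OF R(2)]
  have sp: "space (iid_sample ?Q n) = space (iid_sample ?P n)"
    using sets_iid_sample[OF R(1)] sets_iid_sample[OF R(2)] by (intro sets_eq_imp_space_eq) metis
  define G where "G = {x \<in> space (iid_sample ?P n). E x > A * p / 2 \<and> (\<Sum>i<n. x i) \<le> 4 * t}"
  have GP: "G \<in> P.events" unfolding G_def by measurable
  define \<delta> where "\<delta> = exp (- 5 * t * l)"
  have \<delta>min': "\<delta>min \<le> \<delta>" using \<delta>min by (simp add: \<delta>_def t_def l_def mult_ac)
  have tl: "t * l \<ge> 8" using mult_mono[of 8 t 1 l] t l1 by simp
  have \<delta>4: "\<delta> \<le> 1/4"
  proof -
    have "4 \<le> exp (5 * t * l)" using exp_ge_add_one_self[of "5 * t * l"] tl by linarith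
    then show ?thesis by (simp add: \<delta>_def exp_minus field_simps)
  qed
  have low: "Q.prob {x \<in> space (iid_sample ?Q n). E x \<le> A * p / 2} \<le> 1/4"
  proof -
    have "subgaussian_radius L ?Q n (1/4) \<le> L * sqrt (A * p) * sqrt ((1 + ln 4) / real n)"
      unfolding subgaussian_radius_def using sd(2) L ln4 n0 A0
      by (intro mult_mono mult_nonneg_nonneg) (auto simp: P2_properties(7)[OF P2(2)])
    also have "\<dots> < A * p / 2"
    proof (rule power2_less_imp_less)
      have "(L * sqrt (A * p) * sqrt ((1 + ln 4) / real n))\<^sup>2 = 4 * L\<^sup>2 * (1 + ln 4) * (A * p) / (4 * real n)"
        using A0 ln4 n0 by (simp add: power_mult_distrib)
      also have "\<dots> < real n * (A * p) * (A * p) / (4 * real n)"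
        using n n0 A0 by (intro divide_strict_right_mono mult_strict_right_mono) auto
      also have "\<dots> = (A * p / 2)\<^sup>2" using n0 by (simp add: power2_eq_square)
      finally show "(L * sqrt (A * p) * sqrt ((1 + ln 4) / real n))\<^sup>2 < (A * p / 2)\<^sup>2" .
    qed (use A0 in simp)
    finally have r: "subgaussian_radius L ?Q n (1/4) < A * p / 2" .
    have "Q.prob {x \<in> space (iid_sample ?Q n). E x \<le> A * p / 2} \<le>
      Q.prob {x \<in> space (iid_sample ?Q n). \<bar>E x - dist_mean ?Q\<bar> > subgaussian_radius L ?Q n (1/4)}"
    proof (rule Q.finite_measure_mono)
      show "{x \<in> space (iid_sample ?Q n). E x \<le> A * p / 2} \<subseteq>
         {x \<in> space (iid_sample ?Q n). \<bar>E x - dist_mean ?Q\<bar> > subgaussian_radius L ?Q n (1/4)}"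
      proof safe
        fix x assume "E x \<le> A * p / 2"
        then have "A * p / 2 \<le> \<bar>E x - A * p\<bar>" by linarith
        with r show "subgaussian_radius L ?Q n (1/4) < \<bar>E x - dist_mean ?Q\<bar>" by (simp add: mean)
      qed
    qed measurable
    also have "\<dots> \<le> 1/4" using \<delta>min' \<delta>4 by (intro tail mem) auto
    finally show ?thesis .
  qed
  have high: "Q.prob {x \<in> space (iid_sample ?Q n). (\<Sum>i<n. x i) > 4 * t} \<le> 1/4"
  proof -
    have npos: "n > 0" using n0 by simp
    have r: "2 * (dist_sd ?Q / sqrt (real n)) \<le> 3 * (A * p)"
    proof -
      have "(2 * (dist_sd ?Q / sqrt (real n)))\<^sup>2 = 4 * (dist_sd ?Q)\<^sup>2 / real n"
        using n0 by (simp add: power_mult_distrib power_divide)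
      also have "\<dots> \<le> 4 * (A * p) / real n" using var(2) n0 by (intro divide_right_mono) auto
      also have "\<dots> \<le> 9 * (A * p) * (A * p)"
      proof -
        have "4 * (A * p) \<le> 9 * t * (A * p)" using t A0 by (intro mult_right_mono) auto
        then show ?thesis using n0 by (simp add: t_def divide_le_eq mult_ac)
      qed
      also have "\<dots> = (3 * (A * p))\<^sup>2" by (simp add: power2_eq_square)
      finally show ?thesis by (rule power2_le_imp_le) (use A0 in simp)
    qed
    have "Q.prob {x \<in> space (iid_sample ?Q n). (\<Sum>i<n. x i) > 4 * t} \<le>
      Q.prob {x \<in> space (iid_sample ?Q n). block_mean n 0 x \<in> {y. \<bar>y - dist_mean ?Q\<bar> > 2 * (dist_sd ?Q / sqrt (real n))}}"
    proof (rule Q.finite_measure_mono)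
      show "{x \<in> space (iid_sample ?Q n). (\<Sum>i<n. x i) > 4 * t} \<subseteq>
        {x \<in> space (iid_sample ?Q n). block_mean n 0 x \<in> {y. \<bar>y - dist_mean ?Q\<bar> > 2 * (dist_sd ?Q / sqrt (real n))}}"
      proof safe
        fix x assume "4 * t < (\<Sum>i<n. x i)"
        then have "4 * (A * p) < block_mean n 0 x"
          using n0 by (simp add: block_mean_def t_def less_divide_eq mult_ac)
        with r show "2 * (dist_sd ?Q / sqrt (real n)) < \<bar>block_mean n 0 x - dist_mean ?Q\<bar>"
          unfolding mean by linarith
      qed
    qed (simp add: block_mean_def)
    also have "\<dots> \<le> 1 / 2\<^sup>2"
      using npos by (intro prob_block_mean_far[OF P2(2), of 0 1 n n 2]) auto
    finally show ?thesis by simp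
  qed
  have "1 \<le> Q.prob G + 1/4 + 1/4"
  proof -
    have "Q.prob (space (iid_sample ?Q n)) \<le> Q.prob (G \<union> ({x \<in> space (iid_sample ?Q n). E x \<le> A * p / 2} \<union>
      {x \<in> space (iid_sample ?Q n). (\<Sum>i<n. x i) > 4 * t}))"
      by (intro Q.finite_measure_mono) (auto simp: G_def sp[symmetric] not_le)
    also have "\<dots> \<le> Q.prob G + Q.prob ({x \<in> space (iid_sample ?Q n). E x \<le> A * p / 2} \<union>
      {x \<in> space (iid_sample ?Q n). (\<Sum>i<n. x i) > 4 * t})"
      by (intro measure_Un_le) (auto simp: G_def sp[symmetric])
    also have "Q.prob ({x \<in> space (iid_sample ?Q n). E x \<le> A * p / 2} \<union>
      {x \<in> space (iid_sample ?Q n). (\<Sum>i<n. x i) > 4 * t}) \<le> Q.prob {x \<in> space (iid_sample ?Q n). E x \<le> A * p / 2} +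
       Q.prob {x \<in> space (iid_sample ?Q n). (\<Sum>i<n. x i) > 4 * t}"
      by (intro measure_Un_le) auto
    finally show ?thesis using low high Q.prob_space by linarith
  qed
  then have "1/2 \<le> Q.prob G" by linarith
  also have "\<dots> \<le> (2 * (A * p / p)) powr (4 * t) * P.prob G"
    using p pA GP t by (intro bernoulli_change_of_measure) (auto simp: G_def)
  also have "(2 * (A * p / p)) powr (4 * t) = exp (4 * t * l)"
    using p A by (simp add: powr_def l_def)
  finally have G1: "1/2 \<le> exp (4 * t * l) * P.prob G" .
  have G2: "P.prob G \<le> \<delta>"
  proof -
    have "P.prob G \<le> P.prob {x \<in> space (iid_sample ?P n). \<bar>E x - dist_mean ?P\<bar> > subgaussian_radius L ?P n \<delta>}"
    proof (rule P.finite_measure_mono)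
      have "subgaussian_radius L ?P n \<delta> = L * dist_sd ?P * sqrt ((1 + 5 * t * l) / real n)"
        by (simp add: subgaussian_radius_def \<delta>_def ln_div)
      also have "\<dots> \<le> L * sqrt p * sqrt (p * (10 * A * l))"
      proof (intro mult_mono mult_nonneg_nonneg real_sqrt_le_mono sd(1))
        have "1 + 5 * t * l \<le> 10 * t * l" using tl by linarith
        then have "(1 + 5 * t * l) / real n \<le> 10 * t * l / real n" using n0 by (intro divide_right_mono) auto
        also have "\<dots> = p * (10 * A * l)" using n0 by (simp add: t_def)
        finally show "(1 + 5 * t * l) / real n \<le> p * (10 * A * l)" .
      qed (use L p l1 tl n0 P2_properties(7)[OF P2(1)] in auto)
      also have "\<dots> = p * (L * sqrt (10 * A * l))"
        using p by (simp add: real_sqrt_mult)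
      also have "\<dots> < p * (A / 2 - 1)" using AL p by (intro mult_strict_left_mono) (auto simp: l_def)
      finally have r: "subgaussian_radius L ?P n \<delta> < A * p / 2 - p" by (simp add: algebra_simps)
      show "G \<subseteq> {x \<in> space (iid_sample ?P n). \<bar>E x - dist_mean ?P\<bar> > subgaussian_radius L ?P n \<delta>}"
      proof safe
        fix x assume "x \<in> G"
        then have "x \<in> space (iid_sample ?P n)" "E x > A * p / 2" by (auto simp: G_def)
        then show "x \<in> space (iid_sample ?P n)" "\<bar>E x - dist_mean ?P\<bar> > subgaussian_radius L ?P n \<delta>"
          using r by (auto simp: mean)
      qed
    qed measurable
    also have "\<dots> \<le> \<delta>" using \<delta>min' \<delta>4 by (intro tail mem) auto
    finally show ?thesis .
  qed
  have "exp (4 * t * l) * P.prob G \<le> exp (4 * t * l) * \<delta>" using G2 by (intro mult_left_mono) auto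
  also have "\<dots> = exp (- (t * l))" by (simp add: \<delta>_def exp_add[symmetric])
  also have "\<dots> < 1/2"
  proof -
    have "2 < exp (t * l)" using exp_ge_add_one_self[of "t * l"] tl by linarith
    then show ?thesis by (simp add: exp_minus field_simps)
  qed
  finally show False using G1 by linarith
qed

text \<open>\<open>\<surd>(A ln A)\<close> grows more slowly than \<open>A\<close>.\<close>

lemma exists_large_mean_ratio: "\<exists>A\<ge>2. 1 + L * sqrt (10 * A * ln (2 * A)) < A / (2 :: real)"
proof -
  have "((\<lambda>A. (1 + L * sqrt (10 * A * ln (2 * A))) / A) \<longlongrightarrow> 0) at_top" by real_asymp
  then have "eventually (\<lambda>A. (1 + L * sqrt (10 * A * ln (2 * A))) / A < 1/2) at_top"
    by (rule order_tendstoD) simp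
  then have "eventually (\<lambda>A. A \<ge> 2 \<and> (1 + L * sqrt (10 * A * ln (2 * A))) / A < 1/2) at_top"
    by (intro eventually_conj eventually_ge_at_top)
  then obtain A where "A \<ge> 2" "(1 + L * sqrt (10 * A * ln (2 * A))) / A < 1/2"
    by (auto dest: eventually_happens)
  then show ?thesis by (intro exI[of _ A]) (simp add: field_simps)
qed

text \<open>With \<open>h = \<eta>\<^bsup>-2\<alpha>/(\<alpha> - 2)\<^esup>\<close> one has \<open>k \<le> (C + 1) / h\<close>.  If \<open>2 A h \<le> 1/2\<close>, the Bernoulli laws with parameters \<open>2h\<close> and \<open>2Ah\<close>
  belong to the moment class, and their exponent \<open>2 D n h\<close> is of order \<open>n/k\<close>.  Otherwise \<open>k\<close> is bounded by a multiple of \<open>A\<close>, so a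
  large \<open>c\<close> makes the confidence level smaller than \<open>e\<^bsup>1 - 5 L\<^sup>2 n\<^esup>\<close>.\<close>

theorem no_multiple_delta_estimator:
  assumes \<alpha>: "2 < \<alpha>" "\<alpha> \<le> 3" and C: "C > 0" and L: "L \<ge> sqrt 2"
  shows "\<exists>c>0. \<forall>\<eta>\<ge>7/5. \<exists>n\<^sub>0::nat. \<forall>n\<ge>n\<^sub>0.
    \<not> (\<exists>E. multiple_delta_subgaussian L (P_moment \<alpha> \<eta>) n (exp (1 - c * real n / real (k_reg C \<alpha> \<eta>))) E)"
proof -
  obtain A where A: "A \<ge> 2" "1 + L * sqrt (10 * A * ln (2 * A)) < A / 2"
    using exists_large_mean_ratio by blast
  have L1: "L \<ge> 1" using L by (meson order_trans real_sqrt_ge_1_iff one_le_numeral)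
  define D where "D = 5 * A * ln (2 * A)"
  have D0: "D \<ge> 0" using A by (simp add: D_def)
  define c where "c = (C + 1) * (2 * D + 1) + (C + 1) * (20 * L\<^sup>2 * A)"
  have c1: "c \<ge> (C + 1) * (2 * D + 1)" and c2: "c \<ge> (C + 1) * (20 * L\<^sup>2 * A)" and c0: "c > 0"
  proof -
    have "(C + 1) * (2 * D + 1) > 0" using C D0 by (intro mult_pos_pos) auto
    moreover have "(C + 1) * (20 * L\<^sup>2 * A) \<ge> 0" using C A by (intro mult_nonneg_nonneg) auto
    ultimately show "c \<ge> (C + 1) * (2 * D + 1)" "c \<ge> (C + 1) * (20 * L\<^sup>2 * A)" "c > 0" unfolding c_def by linarith+
  qed
  have "\<exists>n\<^sub>0::nat. \<forall>n\<ge>n\<^sub>0. \<not> (\<exists>E. multiple_delta_subgaussian L (P_moment \<alpha> \<eta>) n (exp (1 - c * real n / real (k_reg C \<alpha> \<eta>))) E)"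
    if \<eta>: "\<eta> \<ge> 7/5" for \<eta>
  proof -
    define h where "h = \<eta> powr (- 2 * \<alpha> / (\<alpha> - 2))"
    define k where "k = real (k_reg C \<alpha> \<eta>)"
    have h0: "h > 0" using \<eta> by (simp add: h_def)
    have hinv: "\<eta> powr (2 * \<alpha> / (\<alpha> - 2)) = 1 / h"
      unfolding h_def using powr_minus_divide[of \<eta> "2 * \<alpha> / (\<alpha> - 2)"] \<eta> by simp
    have h4: "h \<le> 1/4"
    proof -
      have "2 * \<alpha> / (\<alpha> - 2) \<ge> 6" using \<alpha> by (simp add: field_simps)
      then have "\<eta> powr 6 \<le> \<eta> powr (2 * \<alpha> / (\<alpha> - 2))" using \<eta> by (intro powr_mono) auto
      moreover have "\<eta> powr 6 \<ge> (7/5) ^ 6" using \<eta> power_mono[OF \<eta>, of 6] by (simp add: powr_numeral)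
      ultimately have "4 \<le> 1 / h" unfolding hinv by (simp add: power_divide)
      then show ?thesis using h0 by (simp add: field_simps)
    qed
    have k0: "k > 0"
    proof -
      have "0 < C * (1 / h)" using C h0 by simp
      also have "\<dots> \<le> k" using k_reg_ge[of C \<eta> \<alpha>] by (simp add: hinv k_def)
      finally show ?thesis .
    qed
    have kh: "k * h \<le> C + 1"
    proof -
      have "k \<le> C / h + 1" using k_reg_le[OF C, of \<alpha> \<eta>] by (simp add: hinv k_def)
      then have "k * h \<le> (C / h + 1) * h" using h0 by (intro mult_right_mono) auto
      also have "\<dots> = C + h" using h0 by (simp add: field_simps)
      finally show ?thesis using h4 by linarith
    qed
    have ck: "X * h * real n \<le> c * real n / k" if "(C + 1) * X \<le> c" "X \<ge> 0" for X and n :: nat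
    proof -
      have "k * h * X \<le> (C + 1) * X" using kh that by (intro mult_right_mono) auto
      then have "k * h * X * real n \<le> c * real n" using that by (intro mult_right_mono) auto
      then show ?thesis using k0 by (simp add: le_divide_eq mult_ac)
    qed
    show ?thesis
    proof (cases "A * (2 * h) \<le> 1/2")
      case True
      \<comment> \<open>The first term gives \<open>n h \<ge> 1\<close>, which absorbs the \<open>1\<close> in the exponent of the confidence level; the second is the
        sample size at which the larger mean is recognised.\<close>
      let ?n0 = "nat \<lceil>max (1 / h) (4 * L\<^sup>2 * (1 + ln 4) / (A * (2 * h)) + 1)\<rceil>"
      have Ah: "A * (2 * h) > 0" using A h0 by simp
      have "\<not> (\<exists>E. multiple_delta_subgaussian L (P_moment \<alpha> \<eta>) n (exp (1 - c * real n / k)) E)" if n: "n \<ge> ?n0" for n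
      proof -
        have "real n \<ge> max (1 / h) (4 * L\<^sup>2 * (1 + ln 4) / (A * (2 * h)) + 1)" using n by linarith
        then have n1: "real n \<ge> 1 / h" and n2: "real n > 4 * L\<^sup>2 * (1 + ln 4) / (A * (2 * h))" by auto
        have nh: "real n * h \<ge> 1" using n1 h0 by (simp add: field_simps)
        show ?thesis
        proof (rule no_multiple_delta_estimator_bernoulli[where p="2 * h" and A=A])
          show "4 * L\<^sup>2 * (1 + ln 4) < real n * (A * (2 * h))" using n2 Ah by (simp only: pos_divide_less_eq)
          have "1 + D * (real n * (2 * h)) \<le> (2 * D + 1) * h * real n"
            using nh by (simp add: algebra_simps)
          also have "\<dots> \<le> c * real n / k" using c1 D0 by (intro ck) auto
          finally show "exp (1 - c * real n / k) \<le> exp (- 5 * A * ln (2 * A) * (real n * (2 * h)))"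
            by (simp add: D_def)
          have mem: "bernoulli_law p \<in> P_moment \<alpha> \<eta>" if "2 * h \<le> p" "p \<le> 1/2" for p
          proof (rule bernoulli_law_in_P_moment[OF \<alpha>(1)])
            have "2 * h * (1/2) \<le> p * (1 - p)" using that h0 by (intro mult_mono) auto
            then show "\<eta> powr (- 2 * \<alpha> / (\<alpha> - 2)) \<le> p * (1 - p)" by (simp add: h_def)
          qed (use \<eta> that h0 in auto)
          have "2 * h \<le> A * (2 * h)" using A(1) h0 mult_right_mono[of 1 A "2 * h"] by simp
          then show "bernoulli_law (2 * h) \<in> P_moment \<alpha> \<eta>" "bernoulli_law (A * (2 * h)) \<in> P_moment \<alpha> \<eta>"
            using True by (auto intro!: mem)
        qed (use True A L1 h0 in auto)
      qed
      then show ?thesis unfolding k_def by blast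
    next
      case False
      have "\<not> (\<exists>E. multiple_delta_subgaussian L (P_moment \<alpha> \<eta>) n (exp (1 - c * real n / k)) E)" if n: "n \<ge> 1" for n
      proof -
        have "1/4 \<le> A * h" using False by simp
        then have "20 * L\<^sup>2 * real n * (1/4) \<le> 20 * L\<^sup>2 * real n * (A * h)" by (intro mult_left_mono) auto
        then have "5 * L\<^sup>2 * real n \<le> (20 * L\<^sup>2 * A) * h * real n" by (simp add: mult_ac)
        also have "\<dots> \<le> c * real n / k" using c2 A by (intro ck) auto
        finally have "exp (1 - c * real n / k) \<le> exp (1 - 5 * L\<^sup>2 * real n)" by simp
        then show ?thesis
          using no_delta_dependent_estimator[OF \<alpha> \<eta> L n] multiple_delta_imp_delta_dependent by blast
      qed
      then show ?thesis unfolding k_def by blast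
    qed
  qed
  then show ?thesis using c0 by blast
qed

lemma multiple_delta_subgaussian_mono:
  "multiple_delta_subgaussian L \<P>\<^sub>1 n \<delta>min E \<Longrightarrow> \<P>\<^sub>0 \<subseteq> \<P>\<^sub>1 \<Longrightarrow> multiple_delta_subgaussian L \<P>\<^sub>0 n \<delta>min E"
  unfolding multiple_delta_subgaussian_def by blast

text \<open>The lower bound \<open>7/5\<close> suffices twice: it dominates the moment of the contaminated sign, and its sixth power exceeds \<open>4\<close>, which keeps the
  Bernoulli parameter \<open>2h\<close> at most \<open>1/2\<close>.\<close>

lemma eta_threshold: "3 powr (1/3) * 2 powr (1/6) \<ge> (7/5 :: real)"
proof -
  have "(7/5 :: real) = ((7/5) ^ 3) powr (1/3)" by (simp add: powr_numeral[symmetric] powr_powr del: powr_numeral)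
  also have "\<dots> \<le> 3 powr (1/3)" by (intro powr_mono2) (auto simp: power_divide)
  also have "\<dots> \<le> 3 powr (1/3) * 2 powr (1/6)"
    using ge_one_powr_ge_zero[of 2 "1/6 :: real"] by simp
  finally show ?thesis .
qed

theorem theorem3p5:
  fixes \<alpha> :: real
  assumes "2 < \<alpha>" and "\<alpha> \<le> 3"
  shows "\<exists>C>0.
    (\<forall>\<eta>::real. \<eta> \<ge> 3 powr (1/3) * 2 powr (1/6) \<longrightarrow>
       (\<forall>n::nat. real n \<ge> (3 + ln 4) * 124 * real (k_reg C \<alpha> \<eta>) \<longrightarrow>
          (\<exists>E. multiple_delta_subgaussian L_star (P2_reg (k_reg C \<alpha> \<eta>)) n
                 (delta_min n (k_reg C \<alpha> \<eta>)) E \<and>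
               multiple_delta_subgaussian L_star (P_moment \<alpha> \<eta>) n
                 (delta_min n (k_reg C \<alpha> \<eta>)) E))) \<and>
    (\<forall>L::real. L \<ge> sqrt 2 \<longrightarrow>
       (\<exists>c>0. \<forall>\<eta>::real. \<eta> \<ge> 3 powr (1/3) * 2 powr (1/6) \<longrightarrow>
          (\<exists>n\<^sub>0::nat. \<forall>n\<ge>n\<^sub>0.
             \<not> (\<exists>E. multiple_delta_subgaussian L (P_moment \<alpha> \<eta>) n
                     (exp (1 - c * real n / real (k_reg C \<alpha> \<eta>))) E)))) \<and>
    (\<forall>\<eta>::real. \<eta> \<ge> 3 powr (1/3) * 2 powr (1/6) \<longrightarrow>
       (\<forall>L::real. L \<ge> sqrt 2 \<longrightarrow>
          (\<forall>n::nat. n \<ge> 1 \<longrightarrow>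
             \<not> (\<exists>E. delta_dependent_subgaussian L (P_moment \<alpha> \<eta>) n
                     (exp (1 - 5 * L\<^sup>2 * real n)) E))))"
proof -
  obtain C where C: "C > 0" and reg: "\<And>\<eta>. \<eta> \<ge> 1 \<Longrightarrow> P_moment \<alpha> \<eta> \<subseteq> P2_reg (k_reg C \<alpha> \<eta>)"
    using P_moment_subset_P2_reg[OF assms] by blast
  have \<eta>75: "\<eta> \<ge> 7/5" if "\<eta> \<ge> 3 powr (1/3) * 2 powr (1/6)" for \<eta> :: real
    using that eta_threshold by linarith
  show ?thesis
  proof (rule exI[of _ C], intro conjI allI impI C)
    fix \<eta> :: real and n :: nat
    assume \<eta>: "\<eta> \<ge> 3 powr (1/3) * 2 powr (1/6)" and n: "real n \<ge> (3 + ln 4) * 124 * real (k_reg C \<alpha> \<eta>)"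
    have \<eta>1: "\<eta> \<ge> 7/5" by (rule \<eta>75[OF \<eta>])
    have "0 < C * \<eta> powr (2 * \<alpha> / (\<alpha> - 2))" using C \<eta>1 by simp
    also have "\<dots> \<le> real (k_reg C \<alpha> \<eta>)" by (rule k_reg_ge)
    finally have "k_reg C \<alpha> \<eta> \<ge> 1" by simp
    from exists_multiple_delta_estimator_for_regular[OF this n] multiple_delta_subgaussian_mono[OF _ reg]
    show "\<exists>E. multiple_delta_subgaussian L_star (P2_reg (k_reg C \<alpha> \<eta>)) n (delta_min n (k_reg C \<alpha> \<eta>)) E \<and>
               multiple_delta_subgaussian L_star (P_moment \<alpha> \<eta>) n (delta_min n (k_reg C \<alpha> \<eta>)) E"
      using \<eta>1 by fastforce
  next
    fix L :: real assume "L \<ge> sqrt 2"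
    from no_multiple_delta_estimator[OF assms C this] \<eta>75
    show "\<exists>c>0. \<forall>\<eta>::real. \<eta> \<ge> 3 powr (1/3) * 2 powr (1/6) \<longrightarrow>
          (\<exists>n\<^sub>0::nat. \<forall>n\<ge>n\<^sub>0. \<not> (\<exists>E. multiple_delta_subgaussian L (P_moment \<alpha> \<eta>) n
                     (exp (1 - c * real n / real (k_reg C \<alpha> \<eta>))) E))" by meson
  next
    fix \<eta> L :: real and n :: nat
    assume "\<eta> \<ge> 3 powr (1/3) * 2 powr (1/6)" "L \<ge> sqrt 2" "n \<ge> 1"
    then show "\<not> (\<exists>E. delta_dependent_subgaussian L (P_moment \<alpha> \<eta>) n (exp (1 - 5 * L\<^sup>2 * real n)) E)"
      by (intro no_delta_dependent_estimator[OF assms \<eta>75])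
  qed
qed

end
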